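(* In the Hopf cyclic complex of $\tilde{\mathcal K}_1$ with coefficients in ${}^{\sigma^{-1}}\mathbb C$, the $2$-cochain $$\mathfrak u_1:=\mathbf 1\otimes\sigma^{-1}X_1\otimes\sigma^{-1}\log\sigma$$ is a Hochschild cocycle whose Connes boundary is $c_1^{\mathcal K}$, i.e. $B(\mathfrak u_1)=c_1^{\mathcal K}$, where $c_1^{\mathcal K}=\mathbf 1\otimes\sigma^{-2}\sigma^1_{1,1}$.
   Context: $\mathbf G$ is the discrete group of orientation preserving diffeomorphisms of $\mathbb R$; $\mathcal A=C_c^\infty(\mathbb R)\rtimes\mathbf G$ consists of finite sums $\sum f_iU^*_{\varphi_i}$ with $fU^*_\varphi\,gU^*_\psi=f(g\circ\varphi)U^*_{\psi\varphi}$. $\mathcal K_1$ is the unital algebra of operators on $\mathcal A$ generated by $X_1(fU^*_\varphi)=f'U^*_\varphi$ and $\sigma^{\pm1}(fU^*_\varphi)=(\varphi')^{\pm1}fU^*_\varphi$; $\sigma_k(fU^*_\varphi)=\varphi^{(k)}fU^*_\varphi$, $\sigma_1=\sigma$, $\sigma^1_{1,1}=\sigma_2=[X_1,\sigma]$. It is a Hopf algebra with coproduct determined by $k(ab)=k_{(1)}(a)k_{(2)}(b)$ and counit by $k(1)=\varepsilon(k)1$. $\tilde{\mathcal K}_1$ is the Hopf algebra obtained by adjoining to $\mathcal K_1$ a primitive element $\log\sigma$ (acting by $fU^*_\varphi\mapsto\log(\varphi')fU^*_\varphi$), with $[X_1,\log\sigma]=\sigma^{-1}\sigma^1_{1,1}$,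 $[\log\sigma,\sigma_k]=0$ for all $k$, and $\Delta(\log\sigma)=\log\sigma\otimes1+1\otimes\log\sigma$. ${}^{\sigma^{-1}}\mathbb C$ is the one-dimensional module and comodule given by the character $\varepsilon$ and the group-like element $\sigma^{-1}$. The $q$-cochains of the Hopf cyclic complex are elements $\mathbf 1\otimes k^1\otimes\cdots\otimes k^q$ of ${}^{\sigma^{-1}}\mathbb C\otimes\tilde{\mathcal K}_1^{\otimes q}$. The Hochschild coboundary is $b=\sum_{i=0}^{q+1}(-1)^id_i$, with $d_0$ inserting $1$ on the left, $d_i$ applying $\Delta$ to the $i$-th factor for $1\le i\le q$, and $d_{q+1}$ inserting $\sigma^{-1}$ on the right. Cochains are transferred to the cyclic complex of $\mathcal A$ by the characteristic map $\chi_\tau(k^1,\ldots,k^q)(a_0,\ldots,a_q)=\tau(a_0k^1(a_1)\cdots k^q(a_q))$, where $\tau(fU^*_\varphi)=\int_{\mathbb R}f\,dx$ if $\varphi=\mathrm{Id}$ and $0$ otherwise. $B$ is Connes' boundary operator, written in the paper, on a normalized $2$-cochain $u$ on $\mathcal A$, as $B(u)(a,b)=u(1,a,b)-u(1,b,a)$.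
   Formalization: With the stated conventions for the product, τ, χ_τ and B, the Connes boundary of 𝔲₁ is −c₁^K (c₁^K is nonzero, so the stated sign fails); the sign is corrected to B(𝔲₁) = −c₁^K. *)

theory Defs
  imports "HOL-Analysis.Analysis" "HOL-Library.Poly_Mapping"
begin

section \<open>Smooth functions of one real variable\<close>

definition vderiv :: "(real \<Rightarrow> 'a::real_normed_vector) \<Rightarrow> real \<Rightarrow> 'a" where
  "vderiv f = (\<lambda>x. vector_derivative f (at x))"

definition smooth :: "(real \<Rightarrow> 'a::real_normed_vector) \<Rightarrow> bool" where
  "smooth f \<longleftrightarrow> (\<forall>n x. (vderiv ^^ n) f differentiable (at x))"

definition cdiff :: "nat \<Rightarrow> (real \<Rightarrow> 'a::real_normed_vector) \<Rightarrow> bool" where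
  "cdiff n f \<longleftrightarrow> (\<forall>m<n. \<forall>x. (vderiv ^^ m) f differentiable (at x))"

lemma smooth_iff_cdiff: "smooth f \<longleftrightarrow> (\<forall>n. cdiff n f)"
  unfolding smooth_def cdiff_def by blast

lemma cdiff_0 [simp]: "cdiff 0 f"
  by (simp add: cdiff_def)

lemma cdiff_Suc: "cdiff (Suc n) f \<longleftrightarrow> (\<forall>x. f differentiable (at x)) \<and> cdiff n (vderiv f)"
  unfolding cdiff_def by (auto simp: less_Suc_eq_0_disj funpow_swap1)

lemma cdiff_SucD: "cdiff (Suc n) f \<Longrightarrow> cdiff n f"
  unfolding cdiff_def by auto

lemma cdiff_Suc_vderiv: "cdiff (Suc n) f \<Longrightarrow> cdiff n (vderiv f)"
  unfolding cdiff_Suc by simp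

lemma vderivI: "(\<And>x. (f has_vector_derivative f' x) (at x)) \<Longrightarrow> vderiv f = f'"
  unfolding vderiv_def by (auto simp: vector_derivative_at)

lemma has_vderiv: "f differentiable (at x) \<Longrightarrow> (f has_vector_derivative vderiv f x) (at x)"
  unfolding vderiv_def by (simp add: vector_derivative_works)

lemma cdiff_SucI:
  "(\<And>x. (f has_vector_derivative f' x) (at x)) \<Longrightarrow> cdiff n f' \<Longrightarrow> cdiff (Suc n) f"
  unfolding cdiff_Suc using vderivI[of f f'] by (auto intro: differentiableI_vector)

lemma cdiff_has_vderiv: "cdiff (Suc n) f \<Longrightarrow> (f has_vector_derivative vderiv f x) (at x)"
  by (simp add: cdiff_Suc has_vderiv)

lemma smooth_has_vderiv: "smooth f \<Longrightarrow> (f has_vector_derivative vderiv f x) (at x)"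
  using cdiff_has_vderiv smooth_iff_cdiff by blast

lemma smooth_vderiv: "smooth f \<Longrightarrow> smooth (vderiv f)"
  unfolding smooth_iff_cdiff using cdiff_Suc by blast

lemma smooth_funpow_vderiv: "smooth f \<Longrightarrow> smooth ((vderiv ^^ n) f)"
  by (induction n) (auto intro: smooth_vderiv)

lemma cdiff_const [simp]: "cdiff n (\<lambda>x. c)"
  by (induction n arbitrary: c) (auto intro: cdiff_SucI[where f' = "\<lambda>x. 0"])

lemma smooth_const [simp]: "smooth (\<lambda>x. c)"
  by (simp add: smooth_iff_cdiff)

lemma vderiv_ident: "vderiv (\<lambda>x. x) = (\<lambda>x::real. 1)"
  by (rule vderivI) simp

lemma cdiff_ident: "cdiff n (\<lambda>x::real. x)"
  by (cases n) (auto intro!: cdiff_SucI[where f' = "\<lambda>x. 1"])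

lemma smooth_ident: "smooth (\<lambda>x::real. x)"
  by (simp add: smooth_iff_cdiff cdiff_ident)

lemma inv_ident: "inv (\<lambda>x::real. x) = (\<lambda>x. x)"
  by (rule inv_equality) auto

lemma cdiff_add: "cdiff n f \<Longrightarrow> cdiff n g \<Longrightarrow> cdiff n (\<lambda>x. f x + g x)"
proof (induction n arbitrary: f g)
  case (Suc n)
  show ?case
    by (rule cdiff_SucI[where f' = "\<lambda>x. vderiv f x + vderiv g x"])
      (use Suc in \<open>auto intro!: has_vector_derivative_add simp: cdiff_Suc has_vderiv\<close>)
qed simp

lemma smooth_add: "smooth f \<Longrightarrow> smooth g \<Longrightarrow> smooth (\<lambda>x. f x + g x)"
  by (simp add: smooth_iff_cdiff cdiff_add)

lemma cdiff_bilinear: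
  assumes "bounded_bilinear B"
  shows "cdiff n f \<Longrightarrow> cdiff n g \<Longrightarrow> cdiff n (\<lambda>x. B (f x) (g x))"
proof (induction n arbitrary: f g)
  case (Suc n)
  show ?case
  proof (rule cdiff_SucI[where f' = "\<lambda>x. B (f x) (vderiv g x) + B (vderiv f x) (g x)"])
    show "((\<lambda>x. B (f x) (g x)) has_vector_derivative
        B (f x) (vderiv g x) + B (vderiv f x) (g x)) (at x)" for x
      using Suc.prems by (intro bounded_bilinear.has_vector_derivative[OF assms])
        (auto intro: cdiff_has_vderiv)
    show "cdiff n (\<lambda>x. B (f x) (vderiv g x) + B (vderiv f x) (g x))"
      using Suc.prems by (intro cdiff_add Suc.IH) (simp_all add: cdiff_SucD cdiff_Suc_vderiv)
  qed
qed simp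

lemma smooth_bilinear:
  "bounded_bilinear B \<Longrightarrow> smooth f \<Longrightarrow> smooth g \<Longrightarrow> smooth (\<lambda>x. B (f x) (g x))"
  by (simp add: smooth_iff_cdiff cdiff_bilinear)

lemmas smooth_mult = smooth_bilinear[OF bounded_bilinear_mult]
lemmas smooth_scaleR = smooth_bilinear[OF bounded_bilinear_scaleR]

lemma smooth_of_real_mult:
  fixes f :: "real \<Rightarrow> complex"
  shows "smooth w \<Longrightarrow> smooth f \<Longrightarrow> smooth (\<lambda>x. of_real (w x) * f x)"
  using smooth_scaleR[of w f] by (simp add: scaleR_conv_of_real)

lemma smooth_minus: "smooth f \<Longrightarrow> smooth (\<lambda>x. - f x)"
  using smooth_scaleR[of "\<lambda>x. -1" f] by simp

lemma cdiff_compose: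
  fixes h :: "real \<Rightarrow> real"
  shows "cdiff n f \<Longrightarrow> cdiff n h \<Longrightarrow> cdiff n (\<lambda>x. f (h x))"
proof (induction n arbitrary: f)
  case (Suc n)
  show ?case
  proof (rule cdiff_SucI[where f' = "\<lambda>x. vderiv h x *\<^sub>R vderiv f (h x)"])
    show "((\<lambda>x. f (h x)) has_vector_derivative vderiv h x *\<^sub>R vderiv f (h x)) (at x)" for x
      using vector_diff_chain_at[OF cdiff_has_vderiv[OF Suc.prems(2)] cdiff_has_vderiv[OF Suc.prems(1)]]
      by (simp add: o_def)
    show "cdiff n (\<lambda>x. vderiv h x *\<^sub>R vderiv f (h x))"
      using Suc.prems by (intro cdiff_bilinear[OF bounded_bilinear_scaleR] Suc.IH)
        (simp_all add: cdiff_SucD cdiff_Suc_vderiv)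
  qed
qed simp

lemma smooth_compose:
  fixes h :: "real \<Rightarrow> real"
  shows "smooth f \<Longrightarrow> smooth h \<Longrightarrow> smooth (\<lambda>x. f (h x))"
  by (simp add: smooth_iff_cdiff cdiff_compose)

lemma cdiff_inverse:
  fixes w :: "real \<Rightarrow> real"
  assumes "smooth w" "\<And>x. w x \<noteq> 0"
  shows "cdiff n (\<lambda>x. inverse (w x))"
proof (induction n)
  case (Suc n)
  show ?case
  proof (rule cdiff_SucI[where f' = "\<lambda>x. (- vderiv w x) * (inverse (w x) * inverse (w x))"])
    show "((\<lambda>x. inverse (w x)) has_vector_derivative
        (- vderiv w x) * (inverse (w x) * inverse (w x))) (at x)" for x
      using smooth_has_vderiv[OF assms(1), of x] assms(2)[of x]
      by (auto simp: has_real_derivative_iff_has_vector_derivative[symmetric]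
          intro!: derivative_eq_intros)
    show "cdiff n (\<lambda>x. (- vderiv w x) * (inverse (w x) * inverse (w x)))"
      using smooth_minus[OF smooth_vderiv[OF assms(1)]]
      by (intro cdiff_bilinear[OF bounded_bilinear_mult] Suc.IH) (simp add: smooth_iff_cdiff)
  qed
qed simp

lemma smooth_inverse:
  fixes w :: "real \<Rightarrow> real"
  shows "smooth w \<Longrightarrow> (\<And>x. w x \<noteq> 0) \<Longrightarrow> smooth (\<lambda>x. inverse (w x))"
  by (simp add: smooth_iff_cdiff[of "\<lambda>x. inverse (w x)"] cdiff_inverse)

lemma smooth_ln:
  fixes w :: "real \<Rightarrow> real"
  assumes "smooth w" "\<And>x. w x > 0"
  shows "smooth (\<lambda>x. ln (w x))"
  unfolding smooth_iff_cdiff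
proof
  fix n
  have "cdiff (Suc n) (\<lambda>x. ln (w x))"
  proof (rule cdiff_SucI[where f' = "\<lambda>x. vderiv w x * inverse (w x)"])
    show "((\<lambda>x. ln (w x)) has_vector_derivative vderiv w x * inverse (w x)) (at x)" for x
      using smooth_has_vderiv[OF assms(1), of x] assms(2)[of x]
      by (auto simp: has_real_derivative_iff_has_vector_derivative[symmetric] field_simps
          intro!: derivative_eq_intros)
    have "smooth (\<lambda>x. vderiv w x * inverse (w x))"
      using assms less_imp_neq[OF assms(2), THEN not_sym]
      by (intro smooth_mult smooth_vderiv smooth_inverse)
    then show "cdiff n (\<lambda>x. vderiv w x * inverse (w x))"
      by (simp add: smooth_iff_cdiff)
  qed
  then show "cdiff n (\<lambda>x. ln (w x))" by (rule cdiff_SucD)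
qed


section \<open>The group of orientation preserving diffeomorphisms of the line\<close>

typedef diffeo =
  "{\<phi> :: real \<Rightarrow> real. bij \<phi> \<and> smooth \<phi> \<and> smooth (inv \<phi>) \<and> (\<forall>x. vderiv \<phi> x > 0)}"
  morphisms dfun Abs_diffeo
  by (rule exI[of _ "\<lambda>x. x"]) (simp add: vderiv_ident smooth_ident inv_ident bij_def surj_def)

setup_lifting type_definition_diffeo

lift_definition did :: diffeo is "\<lambda>x. x"
  by (simp add: vderiv_ident smooth_ident inv_ident bij_def surj_def)

lift_definition dcomp :: "diffeo \<Rightarrow> diffeo \<Rightarrow> diffeo" is "\<lambda>\<psi> \<phi>. \<psi> \<circ> \<phi>"
proof -
  fix \<psi> \<phi> :: "real \<Rightarrow> real"
  assume a: "bij \<psi> \<and> smooth \<psi> \<and> smooth (inv \<psi>) \<and> (\<forall>x. vderiv \<psi> x > 0)"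
    and b: "bij \<phi> \<and> smooth \<phi> \<and> smooth (inv \<phi>) \<and> (\<forall>x. vderiv \<phi> x > 0)"
  have "vderiv (\<psi> \<circ> \<phi>) = (\<lambda>x. vderiv \<phi> x *\<^sub>R vderiv \<psi> (\<phi> x))"
    using a b by (intro vderivI vector_diff_chain_at) (auto intro: smooth_has_vderiv)
  moreover have "smooth (\<psi> \<circ> \<phi>)"
    using a b smooth_compose[of \<psi> \<phi>] by (simp add: o_def)
  moreover have "smooth (inv (\<psi> \<circ> \<phi>))"
  proof -
    have "inv (\<psi> \<circ> \<phi>) = inv \<phi> \<circ> inv \<psi>" using a b by (intro o_inv_distrib) auto
    moreover have "smooth (\<lambda>x. inv \<phi> (inv \<psi> x))" 
      using a b by (simp add: smooth_compose[of "inv \<phi>" "inv \<psi>"])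
    ultimately show ?thesis by (simp only: o_def)
  qed
  ultimately show "bij (\<psi> \<circ> \<phi>) \<and> smooth (\<psi> \<circ> \<phi>) \<and> smooth (inv (\<psi> \<circ> \<phi>)) \<and>
      (\<forall>x. vderiv (\<psi> \<circ> \<phi>) x > 0)"
    using a b by (simp add: bij_comp)
qed


section \<open>Compactly supported smooth functions\<close>

definition compactly_supported :: "(real \<Rightarrow> complex) \<Rightarrow> bool" where
  "compactly_supported f \<longleftrightarrow> (\<exists>K. compact K \<and> (\<forall>x. x \<notin> K \<longrightarrow> f x = 0))"

typedef ccfun = "{f :: real \<Rightarrow> complex. smooth f \<and> compactly_supported f}"
  morphisms ccf Abs_ccfun
  by (rule exI[of _ "\<lambda>x. 0"]) (auto simp: compactly_supported_def)

setup_lifting type_definition_ccfun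

lemma compactly_supported_add:
  "compactly_supported f \<Longrightarrow> compactly_supported g \<Longrightarrow> compactly_supported (\<lambda>x. f x + g x)"
  unfolding compactly_supported_def
proof (elim exE conjE)
  fix K L assume "compact K" "compact L" "\<forall>x. x \<notin> K \<longrightarrow> f x = 0" "\<forall>x. x \<notin> L \<longrightarrow> g x = 0"
  then show "\<exists>K. compact K \<and> (\<forall>x. x \<notin> K \<longrightarrow> f x + g x = 0)"
    by (intro exI[of _ "K \<union> L"]) (auto intro: compact_Un)
qed

lemma compactly_supported_mult:
  "compactly_supported f \<Longrightarrow> compactly_supported (\<lambda>x. w x * f x)"
  unfolding compactly_supported_def by auto

lemma compactly_supported_vderiv:
  assumes "compactly_supported f"
  shows "compactly_supported (vderiv f)"
proof -
  obtain K where K: "compact K" "\<And>x. x \<notin> K \<Longrightarrow> f x = 0"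
    using assms by (auto simp: compactly_supported_def)
  have "vderiv f x = 0" if "x \<notin> K" for x
  proof -
    have "((\<lambda>x. 0) has_vector_derivative 0) (at x)" by simp
    then have "(f has_vector_derivative 0) (at x)"
      by (rule has_vector_derivative_transform_within_open[where S = "- K"])
        (use that K in \<open>auto simp: compact_imp_closed open_Compl\<close>)
    then show ?thesis by (simp add: vderiv_def vector_derivative_at)
  qed
  then show ?thesis using K(1) by (auto simp: compactly_supported_def)
qed

lemma compactly_supported_compose:
  assumes "compactly_supported f" "bij \<phi>" "smooth (inv \<phi>)"
  shows "compactly_supported (\<lambda>x. f (\<phi> x))"
proof -
  obtain K where K: "compact K" "\<And>x. x \<notin> K \<Longrightarrow> f x = 0"
    using assms by (auto simp: compactly_supported_def)
  have "continuous_on K (inv \<phi>)"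
    using smooth_has_vderiv[OF assms(3)]
    by (intro continuous_at_imp_continuous_on ballI has_vector_derivative_continuous)
  then have "compact (inv \<phi> ` K)" using K(1) compact_continuous_image by blast
  moreover have "f (\<phi> x) = 0" if "x \<notin> inv \<phi> ` K" for x
  proof (rule K(2))
    have "inv \<phi> (\<phi> x) = x" using assms(2) by (simp add: bij_def)
    then show "\<phi> x \<notin> K" using that by (metis image_eqI)
  qed
  ultimately show ?thesis by (auto simp: compactly_supported_def)
qed

instantiation ccfun :: ab_group_add
begin
lift_definition zero_ccfun :: ccfun is "\<lambda>x. 0"
  by (auto simp: compactly_supported_def)
lift_definition plus_ccfun :: "ccfun \<Rightarrow> ccfun \<Rightarrow> ccfun" is "\<lambda>f g x. f x + g x"
  by (simp add: smooth_add compactly_supported_add)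
lift_definition uminus_ccfun :: "ccfun \<Rightarrow> ccfun" is "\<lambda>f x. - f x"
  using compactly_supported_mult[of _ "\<lambda>x. -1"] by (simp add: smooth_minus)
definition minus_ccfun :: "ccfun \<Rightarrow> ccfun \<Rightarrow> ccfun" where
  "minus_ccfun f g = f + (- g)"
instance
  by standard (unfold minus_ccfun_def, (transfer, simp add: algebra_simps fun_eq_iff)+)
end

lift_definition cc_scale :: "complex \<Rightarrow> ccfun \<Rightarrow> ccfun" is "\<lambda>c f x. c * f x"
  by (simp add: smooth_mult compactly_supported_mult)

lift_definition cc_mult :: "ccfun \<Rightarrow> ccfun \<Rightarrow> ccfun" is "\<lambda>f g x. f x * g x"
  by (simp add: smooth_mult compactly_supported_mult)

lift_definition cc_pullback :: "diffeo \<Rightarrow> ccfun \<Rightarrow> ccfun" is "\<lambda>\<phi> g x. g (\<phi> x)"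
proof -
  fix \<phi> :: "real \<Rightarrow> real" and g :: "real \<Rightarrow> complex"
  assume a: "bij \<phi> \<and> smooth \<phi> \<and> smooth (inv \<phi>) \<and> (\<forall>x. vderiv \<phi> x > 0)"
    and b: "smooth g \<and> compactly_supported g"
  show "smooth (\<lambda>x. g (\<phi> x)) \<and> compactly_supported (\<lambda>x. g (\<phi> x))"
    using a b smooth_compose[of g \<phi>] compactly_supported_compose[of g \<phi>] by simp
qed

lift_definition cc_deriv :: "ccfun \<Rightarrow> ccfun" is vderiv
  by (simp add: smooth_vderiv compactly_supported_vderiv)

lift_definition cc_jet :: "nat \<Rightarrow> diffeo \<Rightarrow> ccfun \<Rightarrow> ccfun"
  is "\<lambda>k \<phi> f x. of_real ((vderiv ^^ k) \<phi> x) * f x"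
  by (simp add: smooth_of_real_mult smooth_funpow_vderiv compactly_supported_mult)

lift_definition cc_jet_inv :: "diffeo \<Rightarrow> ccfun \<Rightarrow> ccfun"
  is "\<lambda>\<phi> f x. of_real (inverse (vderiv \<phi> x)) * f x"
proof -
  fix \<phi> :: "real \<Rightarrow> real" and f :: "real \<Rightarrow> complex"
  assume a: "bij \<phi> \<and> smooth \<phi> \<and> smooth (inv \<phi>) \<and> (\<forall>x. vderiv \<phi> x > 0)"
    and b: "smooth f \<and> compactly_supported f"
  have "vderiv \<phi> x \<noteq> 0" for x using a less_irrefl by metis
  then have "smooth (\<lambda>x. inverse (vderiv \<phi> x))"
    using a by (intro smooth_inverse smooth_vderiv) auto
  then show "smooth (\<lambda>x. of_real (inverse (vderiv \<phi> x)) * f x) \<and>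
      compactly_supported (\<lambda>x. of_real (inverse (vderiv \<phi> x)) * f x)"
    using b smooth_of_real_mult[of "\<lambda>x. inverse (vderiv \<phi> x)" f]
      compactly_supported_mult[of f "\<lambda>x. of_real (inverse (vderiv \<phi> x))"] by (intro conjI) auto
qed

lift_definition cc_log :: "diffeo \<Rightarrow> ccfun \<Rightarrow> ccfun"
  is "\<lambda>\<phi> f x. of_real (ln (vderiv \<phi> x)) * f x"
  by (simp add: smooth_ln smooth_of_real_mult smooth_vderiv compactly_supported_mult)


section \<open>The crossed product algebra\<close>

text \<open>A finite sum of terms $f_\varphi U^*_\varphi$ is the finitely supported map sending
  $\varphi$ to its coefficient $f_\varphi$. The ring product that the library puts on
  \<open>poly_mapping\<close> is not used; the product of the crossed product algebra is \<open>xmult\<close>.\<close>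

type_synonym xp = "diffeo \<Rightarrow>\<^sub>0 ccfun"

definition U :: "ccfun \<Rightarrow> diffeo \<Rightarrow> xp" where
  "U f \<phi> = Poly_Mapping.single \<phi> f"

definition xscale :: "complex \<Rightarrow> xp \<Rightarrow> xp" where
  "xscale c a = Poly_Mapping.map (cc_scale c) a"

definition xmult :: "xp \<Rightarrow> xp \<Rightarrow> xp" where
  "xmult a b = (\<Sum>\<phi>\<in>Poly_Mapping.keys a. \<Sum>\<psi>\<in>Poly_Mapping.keys b.
     U (cc_mult (Poly_Mapping.lookup a \<phi>) (cc_pullback \<phi> (Poly_Mapping.lookup b \<psi>)))
       (dcomp \<psi> \<phi>))"

definition tau :: "xp \<Rightarrow> complex" where
  "tau a = (LINT x|lborel. ccf (Poly_Mapping.lookup a did) x)"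


section \<open>The algebras of operators\<close>

type_synonym xop = "xp \<Rightarrow> xp"

definition X1 :: xop where
  "X1 = Poly_Mapping.mapp (\<lambda>\<phi>. cc_deriv)"

definition sigma_k :: "nat \<Rightarrow> xop" where
  "sigma_k k = Poly_Mapping.mapp (cc_jet k)"

definition sigma :: xop where
  "sigma = sigma_k 1"

definition sigma_inv :: xop where
  "sigma_inv = Poly_Mapping.mapp cc_jet_inv"

definition log_sigma :: xop where
  "log_sigma = Poly_Mapping.mapp cc_log"

definition op_add :: "xop \<Rightarrow> xop \<Rightarrow> xop" where
  "op_add k l = (\<lambda>a. k a + l a)"

definition op_scale :: "complex \<Rightarrow> xop \<Rightarrow> xop" where
  "op_scale c k = (\<lambda>a. xscale c (k a))"

inductive_set op_algebra :: "xop set \<Rightarrow> xop set" for S where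
  gen: "k \<in> S \<Longrightarrow> k \<in> op_algebra S"
| one: "id \<in> op_algebra S"
| add: "k \<in> op_algebra S \<Longrightarrow> l \<in> op_algebra S \<Longrightarrow> op_add k l \<in> op_algebra S"
| scale: "k \<in> op_algebra S \<Longrightarrow> op_scale c k \<in> op_algebra S"
| mult: "k \<in> op_algebra S \<Longrightarrow> l \<in> op_algebra S \<Longrightarrow> k \<circ> l \<in> op_algebra S"

definition K1 :: "xop set" where
  "K1 = op_algebra {X1, sigma, sigma_inv}"

text \<open>The algebra with $\log\sigma$ adjoined is taken as an algebra of operators as well. Nothing
  is lost: the jets $\varphi',\varphi'',\dots$ at a point are arbitrary up to $\varphi'>0$ and
  $\log t$ is transcendental over $\mathbb{C}(t)$, so the adjoined element satisfies no relations
  other than $[X_1,\log\sigma]=\sigma^{-1}\sigma_2$ and $[\log\sigma,\sigma_k]=0$. That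
  $\log\sigma$ is primitive is the chain rule for $\log\varphi'$.\<close>

definition K1t :: "xop set" where
  "K1t = op_algebra (insert log_sigma K1)"


section \<open>Tensor powers and the Hopf algebra structure\<close>

text \<open>The tensor powers of \<open>K1t\<close> are quotients of formal combinations of lists of operators,
  a list \<open>[k1, \<dots>, kq]\<close> standing for $k^1\otimes\cdots\otimes k^q$, by the
  multilinearity relations. Equality in the quotient is \<open>tensor_eq\<close>.\<close>

type_synonym tens = "xop list \<Rightarrow>\<^sub>0 complex"

definition tscale :: "complex \<Rightarrow> tens \<Rightarrow> tens" where
  "tscale c t = Poly_Mapping.map ((*) c) t"

definition tensor :: "xop list \<Rightarrow> tens" where
  "tensor ks = Poly_Mapping.single ks 1"

inductive_set tensor_null :: "tens set" where
  zero: "0 \<in> tensor_null"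
| add: "s \<in> tensor_null \<Longrightarrow> t \<in> tensor_null \<Longrightarrow> s + t \<in> tensor_null"
| scale: "t \<in> tensor_null \<Longrightarrow> tscale c t \<in> tensor_null"
| rel_add: "set xs \<subseteq> K1t \<Longrightarrow> set ys \<subseteq> K1t \<Longrightarrow> k \<in> K1t \<Longrightarrow> l \<in> K1t \<Longrightarrow>
    tensor (xs @ [op_add k l] @ ys) - tensor (xs @ [k] @ ys) - tensor (xs @ [l] @ ys)
      \<in> tensor_null"
| rel_scale: "set xs \<subseteq> K1t \<Longrightarrow> set ys \<subseteq> K1t \<Longrightarrow> k \<in> K1t \<Longrightarrow>
    tensor (xs @ [op_scale c k] @ ys) - tscale c (tensor (xs @ [k] @ ys)) \<in> tensor_null"

definition tensor_eq :: "tens \<Rightarrow> tens \<Rightarrow> bool"  (infix \<open>=\<^sub>\<otimes>\<close> 50) where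
  "s =\<^sub>\<otimes> t \<longleftrightarrow> s - t \<in> tensor_null"

definition lin_ext :: "(xop list \<Rightarrow> tens) \<Rightarrow> tens \<Rightarrow> tens" where
  "lin_ext F t = (\<Sum>ks\<in>Poly_Mapping.keys t. tscale (Poly_Mapping.lookup t ks) (F ks))"

text \<open>Since the module of coefficients is one-dimensional, a $q$-cochain
  $\mathbf{1}\otimes k^1\otimes\cdots\otimes k^q$ is identified with
  $k^1\otimes\cdots\otimes k^q$. The coaction of the coefficients is the factor $\sigma^{-1}$ in
  the last coface.\<close>

definition cochains :: "nat \<Rightarrow> tens set" where
  "cochains q = {t. \<forall>ks\<in>Poly_Mapping.keys t. length ks = q \<and> set ks \<subseteq> K1t}"

text \<open>The rule $k(ab)=k_{(1)}(a)k_{(2)}(b)$ determines the coproduct as an element of the tensor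
  square; \<open>coproduct k\<close> is a representative.\<close>

definition coproduct :: "xop \<Rightarrow> tens" where
  "coproduct k = (SOME t. t \<in> cochains 2 \<and>
     (\<forall>a b. k (xmult a b) = (\<Sum>ks\<in>Poly_Mapping.keys t.
        xscale (Poly_Mapping.lookup t ks) (xmult ((ks ! 0) a) ((ks ! 1) b)))))"

text \<open>The counit is given by $k(1)=\varepsilon(k)1$, where $1=1\cdot U^*_{\mathrm{Id}}$ is not in
  the crossed product because the constant function is not compactly supported. The operators are
  local, so $k(1)$ is read off at a point $x$ from functions equal to $1$ near $x$.\<close>

definition counit :: "xop \<Rightarrow> complex" where
  "counit k = (THE c. \<forall>f x. (\<forall>\<^sub>F y in nhds x. ccf f y = 1) \<longrightarrow>
     ccf (Poly_Mapping.lookup (k (U f did)) did) x = c)"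


section \<open>The Hochschild coboundary of the Hopf cyclic complex\<close>

definition coface :: "nat \<Rightarrow> xop list \<Rightarrow> tens" where
  "coface i ks =
    (if i = 0 then tensor (id # ks)
     else if i \<le> length ks
     then lin_ext (\<lambda>pq. tensor (take (i - 1) ks @ pq @ drop i ks)) (coproduct (ks ! (i - 1)))
     else tensor (ks @ [sigma_inv]))"

definition hochschild_b :: "tens \<Rightarrow> tens" where
  "hochschild_b = lin_ext (\<lambda>ks. \<Sum>i\<le>Suc (length ks). tscale ((-1) ^ i) (coface i ks))"


section \<open>Transfer to the crossed product algebra and Connes' boundary operator\<close>

text \<open>As the crossed product is not unital, its cochains are evaluated on the unitization,
  with \<open>(c, a)\<close> standing for $c\,1+a$; the trace is extended by $\tau(1)=0$.\<close>

type_synonym uxp = "complex \<times> xp"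

definition uone :: uxp where
  "uone = (1, 0)"

definition umult :: "uxp \<Rightarrow> uxp \<Rightarrow> uxp" where
  "umult a b = (fst a * fst b, xscale (fst a) (snd b) + xscale (fst b) (snd a) + xmult (snd a) (snd b))"

definition uact :: "xop \<Rightarrow> uxp \<Rightarrow> uxp" where
  "uact k a = (fst a * counit k, k (snd a))"

definition utau :: "uxp \<Rightarrow> complex" where
  "utau a = tau (snd a)"

definition chi_tau :: "tens \<Rightarrow> uxp list \<Rightarrow> complex" where
  "chi_tau t as = (\<Sum>ks\<in>Poly_Mapping.keys t. Poly_Mapping.lookup t ks *
     utau (foldl umult (hd as) (map2 uact ks (tl as))))"

definition normalized2 :: "(uxp list \<Rightarrow> complex) \<Rightarrow> bool" where
  "normalized2 u \<longleftrightarrow> (\<forall>a b. u [a, uone, b] = 0 \<and> u [a, b, uone] = 0)"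

text \<open>Connes' operator from normalized 2-cochains to 1-cochains.\<close>

definition connes_B :: "(uxp list \<Rightarrow> complex) \<Rightarrow> uxp \<Rightarrow> uxp \<Rightarrow> complex" where
  "connes_B u a b = u [uone, a, b] - u [uone, b, a]"

text \<open>On the Hopf cyclic complex the boundary is the 1-cochain, unique in the tensor power, whose
  transfer is the boundary of the transferred cochain.\<close>

definition hopf_B :: "tens \<Rightarrow> tens" where
  "hopf_B u = (SOME c. c \<in> cochains 1 \<and> (\<forall>a b. chi_tau c [a, b] = connes_B (chi_tau u) a b))"

text \<open>Pitfall: with the conventions fixed above the boundary of \<open>u1\<close> is \<open>- c1K\<close>, not \<open>c1K\<close>. For
  $a=fU^*_\varphi$, $b=gU^*_{\varphi^{-1}}$ integration by parts gives
  $B(u_1)(a,b)=-\int (f\cdot(g\circ\varphi))'\log\varphi'\,dx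
    =\int f\,(g\circ\varphi)\,\varphi''/\varphi'\,dx$,
  while $\tau(a\,\sigma^{-2}\sigma_2(b))=-\int f\,(g\circ\varphi)\,\varphi''/\varphi'\,dx$.\<close>

definition u1 :: tens where
  "u1 = tensor [sigma_inv \<circ> X1, sigma_inv \<circ> log_sigma]"

definition c1K :: tens where
  "c1K = tensor [sigma_inv \<circ> sigma_inv \<circ> sigma_k 2]"

end

theory Submission
  imports Defs
begin

text \<open>
  Four facts of different nature carry the result.

  \<^item> The cocycle identity is formal. Twisting by the group-like \<open>sigma_inv\<close> turns the
    \<open>sigma\<close>-derivation \<open>X1\<close> and the primitive \<open>log_sigma\<close> into elements \<open>A\<close>, \<open>L\<close> with
    \<open>\<Delta> A = A \<otimes> sigma_inv + 1 \<otimes> A\<close> and \<open>\<Delta> L = L \<otimes> sigma_inv + sigma_inv \<otimes> L\<close>; the cofaces of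
    \<open>A \<otimes> L\<close> then cancel in pairs (\<open>hochschild_u1\<close>).

  \<^item> The formulas for \<open>\<Delta>\<close> presuppose that the rule \<open>k (a b) = k\<^sub>1(a) k\<^sub>2(b)\<close> determines the
    coproduct, in other words that the tensor square of \<open>K1t\<close> acts faithfully on pairs of elements
    (\<open>tensor_square_faithful\<close>). The operators act on each \<open>f U\<^sub>\<phi>\<close> separately and commute with
    translations of the line, so an operator is known once it is known at one point. In
    \<open>k(f U\<^sub>\<phi>) l(g U\<^sub>\<psi>)\<close> the two factors are evaluated at points that can be varied
    independently; a vanishing sum therefore yields a linear relation between the second factors,
    and the number of summands can be reduced.

  \<^item> The boundary is an integration by parts. On \<open>f U\<^sub>\<phi>\<close> and \<open>g U\<^sub>\<psi>\<close> with \<open>\<psi>\<close> inverse to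
    \<open>\<phi>\<close>, the change of variables \<open>y = \<phi>(x)\<close> combines the two terms of Connes' operator into
    \<open>- \<integral> (f (g \<circ> \<phi>))' ln \<phi>'\<close>. The derivative moved to the logarithm produces \<open>\<phi>'' / \<phi>'\<close>, which is
    \<open>- c1K\<close> because the second jet of the inverse diffeomorphism carries a minus sign
    (\<open>trace_identity_on_terms\<close>). Both factors have counit \<open>0\<close>, so scalars do not interfere.

  \<^item> The trace pairing is nondegenerate: \<open>\<tau>(a k(b))\<close>, for \<open>a\<close> built from the conjugate of the
    coefficient of \<open>k(b)\<close>, is the square of an \<open>L\<^sup>2\<close> norm. Hence a 1-cochain is determined by its
    transfer to the crossed product (\<open>chi_tau_injective\<close>) and the boundary in the Hopf cyclic
    complex can only be \<open>- c1K\<close>.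
\<close>

section \<open>Additive maps on finitely supported functions\<close>

text \<open>The product of the crossed product, the linear extension of maps on pure tensors and the
  characteristic map are all sums of this shape. Treating them alike makes each of them additive,
  so that identities between them have only to be checked on single terms.\<close>

definition psum :: "('a \<Rightarrow> 'b::zero \<Rightarrow> 'c::comm_monoid_add) \<Rightarrow> ('a \<Rightarrow>\<^sub>0 'b) \<Rightarrow> 'c" where
  "psum h t = (\<Sum>k\<in>Poly_Mapping.keys t. h k (Poly_Mapping.lookup t k))"

lemma psum_superset:
  assumes "finite K" "Poly_Mapping.keys t \<subseteq> K" "\<And>k. h k 0 = 0"
  shows "psum h t = (\<Sum>k\<in>K. h k (Poly_Mapping.lookup t k))"
  unfolding psum_def using assms
  by (intro sum.mono_neutral_left) (auto simp: in_keys_iff)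

lemma additive_psum:
  fixes h :: "'a \<Rightarrow> 'b::ab_group_add \<Rightarrow> 'c::ab_group_add"
  assumes "\<And>k. Modules.additive (h k)"
  shows "Modules.additive (psum h)"
proof
  fix s t :: "'a \<Rightarrow>\<^sub>0 'b"
  let ?K = "Poly_Mapping.keys s \<union> Poly_Mapping.keys t"
  have h: "h k 0 = 0" "h k (x + y) = h k x + h k y" for k x y
    using assms[of k] by (auto simp: Modules.additive.zero Modules.additive.add)
  have K: "psum h u = (\<Sum>k\<in>?K. h k (Poly_Mapping.lookup u k))" if "Poly_Mapping.keys u \<subseteq> ?K" for u
    using that by (intro psum_superset h) auto
  show "psum h (s + t) = psum h s + psum h t"
    using Poly_Mapping.keys_add[of s t] by (simp add: K lookup_add h sum.distrib)
qed

lemma psum_single: "h k 0 = 0 \<Longrightarrow> psum h (Poly_Mapping.single k c) = h k c"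
  by (auto simp: psum_def)

lemma sum_singles: "(\<Sum>k\<in>Poly_Mapping.keys t. Poly_Mapping.single k (Poly_Mapping.lookup t k)) = t"
proof (rule poly_mapping_eqI)
  fix k
  show "Poly_Mapping.lookup (\<Sum>k\<in>Poly_Mapping.keys t. Poly_Mapping.single k (Poly_Mapping.lookup t k)) k
      = Poly_Mapping.lookup t k"
    by (cases "k \<in> Poly_Mapping.keys t")
      (auto simp: lookup_sum lookup_single when_def in_keys_iff)
qed

lemma additive_eqI:
  fixes F G :: "('a \<Rightarrow>\<^sub>0 'b::ab_group_add) \<Rightarrow> 'c::ab_group_add"
  assumes "Modules.additive F" "Modules.additive G" "\<And>k c. F (Poly_Mapping.single k c) = G (Poly_Mapping.single k c)"
  shows "F t = G t"
proof -
  let ?S = "\<Sum>k\<in>Poly_Mapping.keys t. Poly_Mapping.single k (Poly_Mapping.lookup t k)"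
  have "F ?S = G ?S"
    unfolding Modules.additive.sum[OF assms(1)] Modules.additive.sum[OF assms(2)] assms(3) ..
  then show ?thesis by (simp only: sum_singles)
qed

section \<open>Linear structure of the crossed product\<close>

lemma ccf_simps [simp]:
  "ccf 0 x = 0" "ccf (f + g) x = ccf f x + ccf g x" "ccf (- f) x = - ccf f x"
  "ccf (f - g) x = ccf f x - ccf g x"
  "ccf (cc_scale c f) x = c * ccf f x" "ccf (cc_mult f g) x = ccf f x * ccf g x"
  "ccf (cc_pullback \<phi> f) x = ccf f (dfun \<phi> x)"
  by (simp_all del: add_uminus_conv_diff add: minus_ccfun_def zero_ccfun.rep_eq plus_ccfun.rep_eq uminus_ccfun.rep_eq
      cc_scale.rep_eq cc_mult.rep_eq cc_pullback.rep_eq)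

lemma ccf_eqI: "(\<And>x. ccf f x = ccf g x) \<Longrightarrow> f = g"
  by (simp add: ccf_inject[symmetric] fun_eq_iff)

lemma lookup_xscale [simp]:
  "Poly_Mapping.lookup (xscale c a) \<phi> = cc_scale c (Poly_Mapping.lookup a \<phi>)"
proof -
  have "cc_scale c 0 = 0" by (rule ccf_eqI) simp
  then show ?thesis by (auto simp: xscale_def Poly_Mapping.map.rep_eq when_def)
qed

lemma xp_eqI:
  "(\<And>\<phi> x. ccf (Poly_Mapping.lookup a \<phi>) x = ccf (Poly_Mapping.lookup b \<phi>) x) \<Longrightarrow> a = b"
  by (intro poly_mapping_eqI ccf_eqI)

lemma U_zero [simp]: "U 0 \<phi> = 0"
  by (simp add: U_def)

lemma U_add: "U (f + g) \<phi> = U f \<phi> + U g \<phi>"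
  by (simp add: U_def single_add)

lemma xscale_U [simp]: "xscale c (U f \<phi>) = U (cc_scale c f) \<phi>"
  by (rule xp_eqI) (simp add: U_def lookup_single when_def)

lemma additive_xscale: "Modules.additive (xscale c)"
  by standard (auto intro!: xp_eqI simp: lookup_add algebra_simps)

lemma xscale_0 [simp]: "xscale 0 a = 0" and xscale_1 [simp]: "xscale 1 a = a"
  and xscale_zero [simp]: "xscale c 0 = 0"
  by (auto intro!: xp_eqI)

lemma xmult_psum:
  "xmult a b = psum (\<lambda>\<phi> f. psum (\<lambda>\<psi> g. U (cc_mult f (cc_pullback \<phi> g)) (dcomp \<psi> \<phi>)) b) a"
  by (simp add: xmult_def psum_def)

lemma xmult_term_add:
  "U (cc_mult f (cc_pullback \<phi> (g + g'))) \<omega> = U (cc_mult f (cc_pullback \<phi> g)) \<omega> + U (cc_mult f (cc_pullback \<phi> g')) \<omega>"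
  "U (cc_mult (f + f') g) \<omega> = U (cc_mult f g) \<omega> + U (cc_mult f' g) \<omega>"
  by (auto simp: U_add[symmetric] intro!: arg_cong[where f = "\<lambda>f. U f \<omega>"] ccf_eqI simp: algebra_simps)

lemma additive_xmult_right: "Modules.additive (xmult a)"
proof
  fix b b'
  have "Modules.additive (psum (\<lambda>\<psi> g. U (cc_mult f (cc_pullback \<phi> g)) (dcomp \<psi> \<phi>)))" for f \<phi>
    by (intro additive_psum) (simp add: Modules.additive_def xmult_term_add)
  then show "xmult a (b + b') = xmult a b + xmult a b'"
    by (simp add: xmult_psum psum_def[of _ a] Modules.additive.add sum.distrib)
qed

lemma additive_xmult_left: "Modules.additive (\<lambda>a. xmult a b)"
  unfolding xmult_psum
  by (intro additive_psum) (simp add: Modules.additive_def xmult_term_add psum_def sum.distrib)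

lemma xmult_zero [simp]: "xmult 0 b = 0" "xmult a 0 = 0"
  using Modules.additive.zero[OF additive_xmult_left] Modules.additive.zero[OF additive_xmult_right] by auto

lemma cc_mult_0 [simp]: "cc_mult 0 g = 0" "cc_mult f 0 = 0" "cc_pullback \<phi> 0 = 0"
  by (auto intro: ccf_eqI)

lemma xmult_U [simp]: "xmult (U f \<phi>) (U g \<psi>) = U (cc_mult f (cc_pullback \<phi> g)) (dcomp \<psi> \<phi>)"
  by (simp add: xmult_psum U_def[of f] U_def[of g] psum_single)

lemma xp_additive_eqI:
  fixes F G :: "xp \<Rightarrow> 'c::ab_group_add"
  assumes "Modules.additive F" "Modules.additive G" "\<And>f \<phi>. F (U f \<phi>) = G (U f \<phi>)"
  shows "F a = G a"
  by (rule additive_eqI[where F = F and G = G]) (use assms in \<open>auto simp: U_def\<close>)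

text \<open>The coproduct formulas and the trace identity are biadditive in two elements of the crossed
  product; on the terms \<open>U f \<phi>\<close> and \<open>U g \<psi>\<close> they become statements of calculus.\<close>

lemma xp_biadditive_eqI:
  fixes F G :: "xp \<Rightarrow> xp \<Rightarrow> 'c::ab_group_add"
  assumes "\<And>b. Modules.additive (\<lambda>a. F a b)" "\<And>a. Modules.additive (F a)" "\<And>b. Modules.additive (\<lambda>a. G a b)" "\<And>a. Modules.additive (G a)"
    and "\<And>f \<phi> g \<psi>. F (U f \<phi>) (U g \<psi>) = G (U f \<phi>) (U g \<psi>)"
  shows "F a b = G a b"
proof (rule xp_additive_eqI[where F = "\<lambda>a. F a b" and G = "\<lambda>a. G a b"])
  show "F (U f \<phi>) b = G (U f \<phi>) b" for f \<phi>
    by (rule xp_additive_eqI[where F = "F (U f \<phi>)" and G = "G (U f \<phi>)"]) (use assms in auto)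
qed (use assms in auto)

lemma additive_comp: "Modules.additive F \<Longrightarrow> Modules.additive G \<Longrightarrow> Modules.additive (\<lambda>x. F (G x))"
  by (simp add: Modules.additive_def)

lemma xmult_xscale [simp]:
  "xmult (xscale c a) b = xscale c (xmult a b)" "xmult a (xscale c b) = xscale c (xmult a b)"
proof -
  have 1: "cc_mult (cc_scale c f) g = cc_scale c (cc_mult f g)" for f g
    by (rule ccf_eqI) simp
  have 2: "cc_mult f (cc_pullback \<phi> (cc_scale c g)) = cc_scale c (cc_mult f (cc_pullback \<phi> g))" for f g \<phi>
    by (rule ccf_eqI) simp
  note [intro] = additive_comp[OF additive_xscale] additive_comp[OF additive_xmult_left additive_xscale]
    additive_comp[OF additive_xmult_right additive_xscale] additive_xmult_left additive_xmult_right
  show "xmult (xscale c a) b = xscale c (xmult a b)"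
    by (rule xp_biadditive_eqI[where F = "\<lambda>a b. xmult (xscale c a) b" and G = "\<lambda>a b. xscale c (xmult a b)"])
      (auto simp: 1)
  show "xmult a (xscale c b) = xscale c (xmult a b)"
    by (rule xp_biadditive_eqI[where F = "\<lambda>a b. xmult a (xscale c b)" and G = "\<lambda>a b. xscale c (xmult a b)"])
      (auto simp: 2)
qed

section \<open>The operators are diagonal and translation equivariant\<close>

lift_definition dshift :: "real \<Rightarrow> diffeo" is "\<lambda>s x. x + s"
proof -
  fix s :: real
  have v: "vderiv (\<lambda>x. x + s) = (\<lambda>x. 1)"
    by (rule vderivI) (auto intro!: derivative_eq_intros)
  have i: "inv (\<lambda>x. x + s) = (\<lambda>x. x + (- s))"
    by (rule inv_equality) auto
  have "bij (\<lambda>x. x + s)"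
    by (rule o_bij[where g = "\<lambda>x. x - s"]) (auto simp: fun_eq_iff)
  moreover have "smooth (\<lambda>x. x + t)" for t :: real
    by (intro smooth_add smooth_ident smooth_const)
  ultimately show "bij (\<lambda>x. x + s) \<and> smooth (\<lambda>x. x + s) \<and> smooth (inv (\<lambda>x. x + s)) \<and>
      (\<forall>x. vderiv (\<lambda>x. x + s) x > 0)"
    by (simp only: v i) simp
qed

lemma dfun_dcomp [simp]: "dfun (dcomp \<psi> \<phi>) x = dfun \<psi> (dfun \<phi> x)"
  by (simp add: dcomp.rep_eq)

lemma dfun_did [simp]: "dfun did x = x"
  by (simp add: did.rep_eq)

lemma dfun_dshift [simp]: "dfun (dshift s) x = x + s"
  by (simp add: dshift.rep_eq)

lemma diffeo_eqI: "(\<And>x. dfun \<phi> x = dfun \<psi> x) \<Longrightarrow> \<phi> = \<psi>"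
  by (simp add: dfun_inject[symmetric] fun_eq_iff)

lemma dfun_smooth [simp]: "smooth (dfun \<phi>)" and dfun_bij: "bij (dfun \<phi>)"
  and vderiv_dfun_pos [simp]: "vderiv (dfun \<phi>) x > 0"
  using dfun[of \<phi>] by auto

lemma ccf_smooth [simp]: "smooth (ccf f)" and ccf_compactly_supported [simp]: "compactly_supported (ccf f)"
  using ccf[of f] by auto

lemma ccf_op_simps [simp]:
  "ccf (cc_deriv f) x = vderiv (ccf f) x"
  "ccf (cc_jet n \<phi> f) x = of_real ((vderiv ^^ n) (dfun \<phi>) x) * ccf f x"
  "ccf (cc_jet_inv \<phi> f) x = of_real (inverse (vderiv (dfun \<phi>) x)) * ccf f x"
  "ccf (cc_log \<phi> f) x = of_real (ln (vderiv (dfun \<phi>) x)) * ccf f x"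
  by (simp_all add: cc_deriv.rep_eq cc_jet.rep_eq cc_jet_inv.rep_eq cc_log.rep_eq)

lemma vderiv_compose:
  fixes h :: "real \<Rightarrow> real"
  assumes "smooth f" "smooth h"
  shows "vderiv (\<lambda>x. f (h x)) = (\<lambda>x. vderiv h x *\<^sub>R vderiv f (h x))"
  using vector_diff_chain_at[OF smooth_has_vderiv[OF assms(2)] smooth_has_vderiv[OF assms(1)]]
  by (intro vderivI) (simp add: o_def)

text \<open>Translations are the only diffeomorphisms with derivative \<open>1\<close> everywhere, so they
  commute with \<open>X1\<close> and merely shift the first jet entering \<open>sigma\<close> and \<open>log_sigma\<close>. This is
  what makes every operator of \<open>K1t\<close> determined by its values at a single point.\<close>

lemma vderiv_shift: "smooth f \<Longrightarrow> vderiv (\<lambda>x. f (x + s)) = (\<lambda>x. vderiv f (x + s))"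
proof -
  assume f: "smooth f"
  have "vderiv (\<lambda>x::real. x + s) = (\<lambda>x. 1)"
    by (rule vderivI) (auto intro!: derivative_eq_intros)
  moreover have "smooth (\<lambda>x. x + s)" by (intro smooth_add smooth_ident smooth_const)
  ultimately show ?thesis using vderiv_compose[OF f, of "\<lambda>x. x + s"] by simp
qed

text \<open>The operators act on each coefficient separately, through maps \<open>\<kappa> \<phi>\<close> of
  functions that commute with precomposition by translations. The condition \<open>\<kappa> \<phi> 0 = 0\<close> is
  what lets \<open>k\<close> be read off on the single terms \<open>U f \<phi>\<close>.\<close>

definition natural_op :: "xop \<Rightarrow> bool" where
  "natural_op k \<longleftrightarrow> (\<exists>\<kappa>.
     (\<forall>a \<phi>. Poly_Mapping.lookup (k a) \<phi> = \<kappa> \<phi> (Poly_Mapping.lookup a \<phi>)) \<and>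
     (\<forall>\<phi>. \<kappa> \<phi> 0 = 0) \<and>
     (\<forall>\<phi> f s. \<kappa> (dcomp \<phi> (dshift s)) (cc_pullback (dshift s) f) = cc_pullback (dshift s) (\<kappa> \<phi> f)))"

lemma lookup_mapp_0:
  "h \<phi> 0 = 0 \<Longrightarrow> Poly_Mapping.lookup (Poly_Mapping.mapp h a) \<phi> = h \<phi> (Poly_Mapping.lookup a \<phi>)"
  by (auto simp: lookup_mapp when_def in_keys_iff)

lemma cc_ops_0 [simp]: "cc_deriv 0 = 0" "cc_jet n \<phi> 0 = 0" "cc_jet_inv \<phi> 0 = 0" "cc_log \<phi> 0 = 0"
proof -
  have "vderiv (ccf 0) = (\<lambda>x. 0)" by (rule vderivI) (simp add: zero_ccfun.rep_eq)
  then show "cc_deriv 0 = 0" by (auto intro: ccf_eqI)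
qed (auto intro: ccf_eqI)

lemma lookup_ops [simp]:
  "Poly_Mapping.lookup (X1 a) \<phi> = cc_deriv (Poly_Mapping.lookup a \<phi>)"
  "Poly_Mapping.lookup (sigma_k n a) \<phi> = cc_jet n \<phi> (Poly_Mapping.lookup a \<phi>)"
  "Poly_Mapping.lookup (sigma a) \<phi> = cc_jet 1 \<phi> (Poly_Mapping.lookup a \<phi>)"
  "Poly_Mapping.lookup (sigma_inv a) \<phi> = cc_jet_inv \<phi> (Poly_Mapping.lookup a \<phi>)"
  "Poly_Mapping.lookup (log_sigma a) \<phi> = cc_log \<phi> (Poly_Mapping.lookup a \<phi>)"
  by (simp_all add: X1_def sigma_k_def sigma_def sigma_inv_def log_sigma_def lookup_mapp_0)

lemma ccf_pullback_fun: "ccf (cc_pullback \<phi> f) = (\<lambda>x. ccf f (dfun \<phi> x))"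
  and dfun_dcomp_fun: "dfun (dcomp \<psi> \<phi>) = (\<lambda>x. dfun \<psi> (dfun \<phi> x))"
  and dfun_dshift_fun: "dfun (dshift s) = (\<lambda>x. x + s)"
  by (simp_all add: fun_eq_iff)

lemma natural_op_mapp:
  assumes "\<And>\<phi>. h \<phi> 0 = 0"
    and "\<And>\<phi> f s. h (dcomp \<phi> (dshift s)) (cc_pullback (dshift s) f) = cc_pullback (dshift s) (h \<phi> f)"
  shows "natural_op (Poly_Mapping.mapp h)"
  unfolding natural_op_def by (rule exI[of _ h]) (simp add: assms lookup_mapp_0)

lemma natural_op_gens: "natural_op X1" "natural_op sigma" "natural_op sigma_inv" "natural_op log_sigma"
  unfolding X1_def sigma_def sigma_k_def sigma_inv_def log_sigma_def
  by (intro natural_op_mapp; (rule ccf_eqI)?;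
      simp add: ccf_pullback_fun dfun_dcomp_fun dfun_dshift_fun vderiv_shift)+

lemma natural_op_id: "natural_op id"
  unfolding natural_op_def by (rule exI[of _ "\<lambda>\<phi> f. f"]) simp

lemma natural_op_add: "natural_op k \<Longrightarrow> natural_op l \<Longrightarrow> natural_op (op_add k l)"
  unfolding natural_op_def
proof (elim exE, goal_cases)
  case (1 \<kappa> \<mu>)
  then show ?case
    by (intro exI[of _ "\<lambda>\<phi> f. \<kappa> \<phi> f + \<mu> \<phi> f"]) (auto simp: op_add_def lookup_add intro: ccf_eqI)
qed

lemma natural_op_scale: "natural_op k \<Longrightarrow> natural_op (op_scale c k)"
  unfolding natural_op_def
proof (elim exE, goal_cases)
  case (1 \<kappa>)
  then show ?case
    by (intro exI[of _ "\<lambda>\<phi> f. cc_scale c (\<kappa> \<phi> f)"]) (auto simp: op_scale_def intro: ccf_eqI)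
qed

lemma natural_op_comp: "natural_op k \<Longrightarrow> natural_op l \<Longrightarrow> natural_op (k \<circ> l)"
  unfolding natural_op_def
proof (elim exE, goal_cases)
  case (1 \<kappa> \<mu>)
  then show ?case
    by (intro exI[of _ "\<lambda>\<phi> f. \<kappa> \<phi> (\<mu> \<phi> f)"]) auto
qed

lemma natural_op_algebra: "k \<in> op_algebra S \<Longrightarrow> (\<And>k. k \<in> S \<Longrightarrow> natural_op k) \<Longrightarrow> natural_op k"
  by (induction rule: op_algebra.induct)
    (auto intro: natural_op_id natural_op_add natural_op_scale natural_op_comp)

lemma natural_op_K1t: "k \<in> K1t \<Longrightarrow> natural_op k"
  unfolding K1t_def K1_def
  by (elim natural_op_algebra) (auto intro: natural_op_gens elim!: natural_op_algebra)

definition component :: "xop \<Rightarrow> diffeo \<Rightarrow> ccfun \<Rightarrow> ccfun" where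
  "component k \<phi> f = Poly_Mapping.lookup (k (U f \<phi>)) \<phi>"

lemma natural_op_component:
  assumes "natural_op k"
  shows "Poly_Mapping.lookup (k a) \<phi> = component k \<phi> (Poly_Mapping.lookup a \<phi>)"
    and "k (U f \<phi>) = U (component k \<phi> f) \<phi>"
    and "component k (dcomp \<phi> (dshift s)) (cc_pullback (dshift s) f) = cc_pullback (dshift s) (component k \<phi> f)"
proof -
  obtain \<kappa> where \<kappa>: "\<And>a \<phi>. Poly_Mapping.lookup (k a) \<phi> = \<kappa> \<phi> (Poly_Mapping.lookup a \<phi>)" "\<And>\<phi>. \<kappa> \<phi> 0 = 0"
    "\<And>\<phi> f s. \<kappa> (dcomp \<phi> (dshift s)) (cc_pullback (dshift s) f) = cc_pullback (dshift s) (\<kappa> \<phi> f)"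
    using assms unfolding natural_op_def by metis
  have c: "component k = \<kappa>" by (simp add: fun_eq_iff component_def \<kappa>(1) U_def)
  show "Poly_Mapping.lookup (k a) \<phi> = component k \<phi> (Poly_Mapping.lookup a \<phi>)"
    "component k (dcomp \<phi> (dshift s)) (cc_pullback (dshift s) f) = cc_pullback (dshift s) (component k \<phi> f)"
    by (simp_all add: c \<kappa>)
  show "k (U f \<phi>) = U (component k \<phi> f) \<phi>"
    by (rule poly_mapping_eqI) (simp add: c \<kappa> U_def lookup_single when_def)
qed

section \<open>Calculus in the tensor powers\<close>

lemma lookup_tscale [simp]: "Poly_Mapping.lookup (tscale c t) k = c * Poly_Mapping.lookup t k"
  by (auto simp: tscale_def Poly_Mapping.map.rep_eq when_def)

lemma additive_tscale: "Modules.additive (tscale c)"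
  by standard (auto intro!: poly_mapping_eqI simp: lookup_add algebra_simps)

lemma tscale_simps [simp]: "tscale 1 t = t" "tscale (- 1) t = - t" "tscale 0 t = 0"
  "tscale c 0 = 0" "tscale c (tscale d t) = tscale (c * d) t"
  by (auto intro!: poly_mapping_eqI)

lemma tscale_diff: "tscale c (s - t) = tscale c s - tscale c t"
  and tscale_add_left: "tscale (c + d) t = tscale c t + tscale d t"
  by (auto intro!: poly_mapping_eqI simp: lookup_add lookup_minus algebra_simps)

lemma single_eq_tscale: "Poly_Mapping.single ks c = tscale c (tensor ks)"
  by (rule poly_mapping_eqI) (simp add: tensor_def lookup_single when_def)

lemma tensor_null_uminus: "t \<in> tensor_null \<Longrightarrow> - t \<in> tensor_null"
  using tensor_null.scale[of t "-1"] by simp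

lemma tensor_eq_refl: "t =\<^sub>\<otimes> t"
  by (simp add: tensor_eq_def tensor_null.zero)

lemma tensor_eq_sym: "s =\<^sub>\<otimes> t \<Longrightarrow> t =\<^sub>\<otimes> s"
  using tensor_null_uminus[of "s - t"] by (simp add: tensor_eq_def)

lemma tensor_eq_trans [trans]: "s =\<^sub>\<otimes> t \<Longrightarrow> t =\<^sub>\<otimes> u \<Longrightarrow> s =\<^sub>\<otimes> u"
  using tensor_null.add[of "s - t" "t - u"] by (simp add: tensor_eq_def)

lemma tensor_eq_add: "s =\<^sub>\<otimes> t \<Longrightarrow> s' =\<^sub>\<otimes> t' \<Longrightarrow> s + s' =\<^sub>\<otimes> t + t'"
  using tensor_null.add[of "s - t" "s' - t'"] by (simp add: tensor_eq_def algebra_simps)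

lemma tensor_eq_uminus: "s =\<^sub>\<otimes> t \<Longrightarrow> - s =\<^sub>\<otimes> - t"
  using tensor_null_uminus[of "s - t"] by (simp add: tensor_eq_def algebra_simps)

lemma tensor_eq_diff: "s =\<^sub>\<otimes> t \<Longrightarrow> s' =\<^sub>\<otimes> t' \<Longrightarrow> s - s' =\<^sub>\<otimes> t - t'"
  using tensor_eq_add[OF _ tensor_eq_uminus, of s t s' t'] by simp

lemma tensor_eq_null: "s =\<^sub>\<otimes> t \<Longrightarrow> s \<in> tensor_null \<longleftrightarrow> t \<in> tensor_null"
  using tensor_eq_sym[of s t] tensor_null.add[of "s - t" t] tensor_null.add[of "t - s" s]
  by (auto simp: tensor_eq_def)

lemma tensor_op_add:
  assumes "set xs \<subseteq> K1t" "set ys \<subseteq> K1t" "k \<in> K1t" "l \<in> K1t"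
  shows "tensor (xs @ [op_add k l] @ ys) =\<^sub>\<otimes> tensor (xs @ [k] @ ys) + tensor (xs @ [l] @ ys)"
  using tensor_null.rel_add[OF assms] by (simp add: tensor_eq_def algebra_simps)

lemma tensor_op_scale:
  assumes "set xs \<subseteq> K1t" "set ys \<subseteq> K1t" "k \<in> K1t"
  shows "tensor (xs @ [op_scale c k] @ ys) =\<^sub>\<otimes> tscale c (tensor (xs @ [k] @ ys))"
  using tensor_null.rel_scale[OF assms] by (simp add: tensor_eq_def)

lemma K1t_closed: "id \<in> K1t" "k \<in> K1t \<Longrightarrow> l \<in> K1t \<Longrightarrow> op_add k l \<in> K1t"
  "k \<in> K1t \<Longrightarrow> op_scale c k \<in> K1t" "k \<in> K1t \<Longrightarrow> l \<in> K1t \<Longrightarrow> k \<circ> l \<in> K1t"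
  unfolding K1t_def by (auto intro: op_algebra.intros)

lemma tensor_zero_op:
  assumes "set xs \<subseteq> K1t" "set ys \<subseteq> K1t"
  shows "tensor (xs @ [\<lambda>a. 0] @ ys) \<in> tensor_null"
proof -
  have "op_scale 0 id = (\<lambda>a. 0)" by (simp add: op_scale_def)
  then show ?thesis
    using tensor_op_scale[OF assms K1t_closed(1), of 0] by (simp add: tensor_eq_def)
qed

definition lincomb :: "('b \<Rightarrow> complex) \<Rightarrow> ('b \<Rightarrow> xop) \<Rightarrow> 'b list \<Rightarrow> xop" where
  "lincomb c k is = foldr (\<lambda>i. op_add (op_scale (c i) (k i))) is (\<lambda>a. 0)"

lemma lincomb_simps: "lincomb c k [] = (\<lambda>a. 0)"
  "lincomb c k (i # is) = op_add (op_scale (c i) (k i)) (lincomb c k is)"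
  by (simp_all add: lincomb_def)

lemma zero_op_K1t: "(\<lambda>a. 0) \<in> K1t"
  using K1t_closed(3)[OF K1t_closed(1), of 0] by (simp add: op_scale_def)

lemma lincomb_K1t: "(\<And>i. i \<in> set is \<Longrightarrow> k i \<in> K1t) \<Longrightarrow> lincomb c k is \<in> K1t"
  by (induction "is") (auto simp: lincomb_simps intro: K1t_closed zero_op_K1t)

lemma lincomb_apply: "lincomb c k is a = (\<Sum>i\<leftarrow>is. xscale (c i) (k i a))"
  by (induction "is") (auto simp: lincomb_simps op_add_def op_scale_def)

text \<open>Both faithfulness arguments below trade a linear relation between operators for a
  relation between tensors through this multilinear expansion.\<close>

lemma tensor_lincomb:
  assumes "set xs \<subseteq> K1t" "set ys \<subseteq> K1t" "\<And>i. i \<in> set is \<Longrightarrow> k i \<in> K1t"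
  shows "tensor (xs @ [lincomb c k is] @ ys) =\<^sub>\<otimes> (\<Sum>i\<leftarrow>is. tscale (c i) (tensor (xs @ [k i] @ ys)))"
  using assms(3)
proof (induction "is")
  case Nil
  then show ?case using tensor_zero_op[OF assms(1,2)] by (simp add: lincomb_simps tensor_eq_def)
next
  case (Cons i "is")
  have "tensor (xs @ [lincomb c k (i # is)] @ ys) =\<^sub>\<otimes>
      tensor (xs @ [op_scale (c i) (k i)] @ ys) + tensor (xs @ [lincomb c k is] @ ys)"
    unfolding lincomb_simps using Cons.prems
    by (intro tensor_op_add assms(1,2) K1t_closed(3) lincomb_K1t) simp_all
  also have "\<dots> =\<^sub>\<otimes> tscale (c i) (tensor (xs @ [k i] @ ys)) + (\<Sum>i\<leftarrow>is. tscale (c i) (tensor (xs @ [k i] @ ys)))"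
    using Cons by (intro tensor_eq_add tensor_op_scale assms(1,2) Cons.IH) simp_all
  finally show ?case by simp
qed

lemma tensor_eq_sum_list:
  "(\<And>i. i \<in> set is \<Longrightarrow> f i =\<^sub>\<otimes> g i) \<Longrightarrow> (\<Sum>i\<leftarrow>is. f i) =\<^sub>\<otimes> (\<Sum>i\<leftarrow>is. g i)"
  by (induction "is") (auto intro: tensor_eq_refl tensor_eq_add)

section \<open>The tensor square acts faithfully\<close>

lemma natural_op_eqI:
  assumes "natural_op k" "natural_op l"
    "\<And>\<psi> g y. ccf (component k \<psi> g) y = ccf (component l \<psi> g) y"
  shows "k = l"
  by (intro ext xp_eqI) (simp add: natural_op_component(1) assms)

lemma component_lincomb:
  assumes "\<And>i. i \<in> set is \<Longrightarrow> natural_op (k i)"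
  shows "ccf (component (lincomb c k is) \<psi> g) y = (\<Sum>i\<leftarrow>is. c i * ccf (component (k i) \<psi> g) y)"
  using assms by (induction "is") (auto simp: component_def lincomb_apply lookup_add)

text \<open>A value at one point for all \<open>\<psi>\<close> and \<open>g\<close> gives the value at every other point.\<close>

lemma component_translate:
  "natural_op k \<Longrightarrow> ccf (component k \<psi> g) (y + s)
     = ccf (component k (dcomp \<psi> (dshift s)) (cc_pullback (dshift s) g)) y"
  by (simp add: natural_op_component(3))

text \<open>The product \<open>k (U f \<phi>) l (U g \<psi>)\<close> evaluated at \<open>x\<close> involves the first operator
  only at \<open>x\<close> and the second only at \<open>\<phi>(x)\<close>. Moving \<open>(\<psi>, g)\<close> by the translation that takes
  \<open>\<phi>(x)\<close> to \<open>y\<close> makes the two points independent.\<close>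

lemma relation_of_vanishing_action:
  assumes nat: "\<And>k l. (k, l) \<in> set ps \<Longrightarrow> natural_op k \<and> natural_op l"
    and zero: "\<And>a b. (\<Sum>(k, l)\<leftarrow>ps. xmult (k a) (l b)) = 0"
  shows "(\<Sum>(k, l)\<leftarrow>ps. ccf (component k \<phi> f) x * ccf (component l \<psi> g) y) = 0"
proof -
  let ?T = "dshift (y - dfun \<phi> x)"
  let ?\<psi> = "dcomp \<psi> ?T" and ?g = "cc_pullback ?T g"
  have "ccf (Poly_Mapping.lookup (\<Sum>(k, l)\<leftarrow>qs. xmult (k (U f \<phi>)) (l (U ?g ?\<psi>))) (dcomp ?\<psi> \<phi>)) x
      = (\<Sum>(k, l)\<leftarrow>qs. ccf (component k \<phi> f) x * ccf (component l \<psi> g) y)" if "set qs \<subseteq> set ps" for qs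
    using that
  proof (induction qs)
    case (Cons p qs)
    obtain k l where p: "p = (k, l)" by fastforce
    then have kl: "natural_op k" "natural_op l" using nat Cons.prems by auto
    have "ccf (component l \<psi> g) y = ccf (component l ?\<psi> ?g) (dfun \<phi> x)"
      using component_translate[OF kl(2), of \<psi> g "dfun \<phi> x" "y - dfun \<phi> x"] by simp
    then have "ccf (Poly_Mapping.lookup (xmult (k (U f \<phi>)) (l (U ?g ?\<psi>))) (dcomp ?\<psi> \<phi>)) x
        = ccf (component k \<phi> f) x * ccf (component l \<psi> g) y"
      unfolding natural_op_component(2)[OF kl(1)] natural_op_component(2)[OF kl(2)] xmult_U
      by (simp add: U_def)
    then show ?case using Cons p by (simp add: lookup_add)
  qed simp
  from this[of ps] show ?thesis by (simp add: zero)
qed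

text \<open>If some value of the first operator \<open>k\<close> is nonzero, freezing the first arguments there
  turns the vanishing of the action into a linear relation that expresses \<open>l\<close> through the
  other second factors. Substituting it absorbs the summand \<open>k \<otimes> l\<close> into the others and leaves a
  shorter sum with the same action, so induction on the number of summands applies.\<close>

lemma tensor_square_faithful_list:
  assumes "\<And>k l. (k, l) \<in> set ps \<Longrightarrow> k \<in> K1t \<and> l \<in> K1t"
    and "\<And>a b. (\<Sum>(k, l)\<leftarrow>ps. xmult (k a) (l b)) = 0"
  shows "(\<Sum>(k, l)\<leftarrow>ps. tensor [k, l]) \<in> tensor_null"
  using assms
proof (induction "length ps" arbitrary: ps)
  case 0
  then show ?case by (simp add: tensor_null.zero)
next
  case (Suc n)
  from Suc.hyps(2) obtain k l qs where ps: "ps = (k, l) # qs" and n: "length qs = n"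
    by (auto simp: Suc_length_conv)
  have kl: "k \<in> K1t" "l \<in> K1t" and qs: "\<And>k l. (k, l) \<in> set qs \<Longrightarrow> k \<in> K1t \<and> l \<in> K1t"
    using Suc.prems(1) ps by auto
  show ?case
  proof (cases "k = (\<lambda>a. 0)")
    case True
    have "(\<Sum>(k, l)\<leftarrow>qs. tensor [k, l]) \<in> tensor_null"
    proof (rule Suc.hyps(1))
      show "(\<Sum>(k, l)\<leftarrow>qs. xmult (k a) (l b)) = 0" for a b
        using Suc.prems(2)[of a b] by (simp add: ps True)
    qed (use n qs in auto)
    moreover have "tensor [k, l] \<in> tensor_null"
      using tensor_zero_op[of "[]" "[l]"] kl by (simp add: True)
    ultimately show ?thesis by (simp add: ps tensor_null.add)
  next
    case False
    then obtain \<phi> f x where nz: "ccf (component k \<phi> f) x \<noteq> 0"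
      using natural_op_eqI[OF natural_op_K1t[OF kl(1)] natural_op_K1t[OF zero_op_K1t]]
      by (auto simp: component_def)
    \<comment> \<open>The coefficients of \<open>l\<close> in terms of the other second factors, read off from the first
      factors at the point where \<open>k\<close> does not vanish.\<close>
    define c where "c = (\<lambda>(k', l'::xop). - ccf (component k' \<phi> f) x / ccf (component k \<phi> f) x)"
    have l: "l = lincomb c snd qs"
    proof (rule natural_op_eqI)
      fix \<psi> g y
      have "(\<Sum>(k, l)\<leftarrow>ps. ccf (component k \<phi> f) x * ccf (component l \<psi> g) y) = 0"
        using Suc.prems(1) natural_op_K1t by (intro relation_of_vanishing_action Suc.prems(2)) auto
      moreover have "(\<Sum>(k', l')\<leftarrow>rs. ccf (component k' \<phi> f) x * ccf (component l' \<psi> g) y)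
          = - ccf (component k \<phi> f) x * (\<Sum>i\<leftarrow>rs. c i * ccf (component (snd i) \<psi> g) y)" for rs
        using nz by (induction rs) (auto simp: c_def field_simps)
      ultimately have "ccf (component l \<psi> g) y = (\<Sum>i\<leftarrow>qs. c i * ccf (component (snd i) \<psi> g) y)"
        using nz by (simp add: ps)
      also have "\<dots> = ccf (component (lincomb c snd qs) \<psi> g) y"
        using qs natural_op_K1t by (subst component_lincomb) auto
      finally show "ccf (component l \<psi> g) y = ccf (component (lincomb c snd qs) \<psi> g) y" .
    qed (use kl qs in \<open>auto intro!: natural_op_K1t lincomb_K1t\<close>)
    \<comment> \<open>By bilinearity \<open>k \<otimes> \<Sum> c\<^sub>i l\<^sub>i\<close> merges into \<open>\<Sum> (k\<^sub>i + c\<^sub>i k) \<otimes> l\<^sub>i\<close>.\<close>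
    define r where "r = (\<lambda>i. (op_add (fst i) (op_scale (c i) k), snd i))"
    have "(\<Sum>(k, l)\<leftarrow>map r qs. tensor [k, l]) \<in> tensor_null"
    proof (rule Suc.hyps(1))
      fix a b
      have "(\<Sum>(k', l')\<leftarrow>map r rs. xmult (k' a) (l' b))
          = (\<Sum>(k', l')\<leftarrow>rs. xmult (k' a) (l' b)) + xmult (k a) (lincomb c snd rs b)" for rs
        by (induction rs)
          (auto simp: r_def op_add_def op_scale_def lincomb_apply Modules.additive.add[OF additive_xmult_left]
            Modules.additive.add[OF additive_xmult_right])
      then have "(\<Sum>(k', l')\<leftarrow>map r qs. xmult (k' a) (l' b)) = (\<Sum>(k', l')\<leftarrow>ps. xmult (k' a) (l' b))"
        by (simp add: ps l[symmetric])
      then show "(\<Sum>(k', l')\<leftarrow>map r qs. xmult (k' a) (l' b)) = 0"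
        using Suc.prems(2) by simp
    qed (use n qs kl in \<open>auto simp: r_def intro: K1t_closed\<close>)
    moreover have "(\<Sum>(k, l)\<leftarrow>ps. tensor [k, l]) =\<^sub>\<otimes> (\<Sum>(k, l)\<leftarrow>map r qs. tensor [k, l])"
    proof -
      have 1: "tensor [k, l] =\<^sub>\<otimes> (\<Sum>i\<leftarrow>qs. tscale (c i) (tensor [k, snd i]))"
        using tensor_lincomb[of "[k]" "[]" qs snd c] kl qs by (auto simp: l[symmetric])
      have 2: "tensor [k', l'] + tscale (c (k', l')) (tensor [k, l']) =\<^sub>\<otimes> tensor [fst (r (k', l')), l']"
        if "(k', l') \<in> set qs" for k' l'
      proof (rule tensor_eq_sym)
        have "tensor [op_add k' (op_scale (c (k', l')) k), l'] =\<^sub>\<otimes> tensor [k', l'] + tensor [op_scale (c (k', l')) k, l']"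
          using tensor_op_add[of "[]" "[l']" k' "op_scale (c (k', l')) k"] qs[OF that] kl
          by (simp add: K1t_closed)
        also have "\<dots> =\<^sub>\<otimes> tensor [k', l'] + tscale (c (k', l')) (tensor [k, l'])"
          using tensor_op_scale[of "[]" "[l']" k] qs[OF that] kl by (intro tensor_eq_add tensor_eq_refl) simp
        finally show "tensor [fst (r (k', l')), l'] =\<^sub>\<otimes> tensor [k', l'] + tscale (c (k', l')) (tensor [k, l'])"
          by (simp add: r_def)
      qed
      have "(\<Sum>(k, l)\<leftarrow>ps. tensor [k, l]) = tensor [k, l] + (\<Sum>(k, l)\<leftarrow>qs. tensor [k, l])"
        by (simp add: ps)
      also have "\<dots> =\<^sub>\<otimes> (\<Sum>i\<leftarrow>qs. tscale (c i) (tensor [k, snd i])) + (\<Sum>(k, l)\<leftarrow>qs. tensor [k, l])"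
        by (intro tensor_eq_add 1 tensor_eq_refl)
      also have "\<dots> = (\<Sum>i\<leftarrow>qs. tensor [fst i, snd i] + tscale (c i) (tensor [k, snd i]))"
        by (simp add: sum_list_addf case_prod_unfold add.commute)
      also have "\<dots> =\<^sub>\<otimes> (\<Sum>i\<leftarrow>qs. tensor [fst (r i), snd i])"
        using 2 by (intro tensor_eq_sum_list) auto
      also have "(\<Sum>i\<leftarrow>qs. tensor [fst (r i), snd i]) = (\<Sum>(k, l)\<leftarrow>map r qs. tensor [k, l])"
        by (simp add: case_prod_unfold o_def) (simp add: r_def)
      finally show ?thesis .
    qed
    ultimately show ?thesis by (simp add: tensor_eq_null)
  qed
qed

definition tensor_act :: "tens \<Rightarrow> xp \<Rightarrow> xp \<Rightarrow> xp" where
  "tensor_act t a b = (\<Sum>ks\<in>Poly_Mapping.keys t.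
     xscale (Poly_Mapping.lookup t ks) (xmult ((ks ! 0) a) ((ks ! 1) b)))"

lemma tens_expand: "t = (\<Sum>ks\<in>Poly_Mapping.keys t. tscale (Poly_Mapping.lookup t ks) (tensor ks))"
  by (subst sum_singles[of t, symmetric]) (simp only: single_eq_tscale)

text \<open>A coproduct is prescribed only through its action on products; faithfulness of that
  action is what turns the prescription into an element of the tensor square.\<close>

lemma tensor_square_faithful:
  assumes t: "t \<in> cochains 2" and zero: "\<And>a b. tensor_act t a b = 0"
  shows "t \<in> tensor_null"
proof -
  obtain kss where kss: "set kss = Poly_Mapping.keys t" "distinct kss"
    using finite_distinct_list[OF Poly_Mapping.finite_keys[of t]] by blast
  let ?c = "Poly_Mapping.lookup t"
  have len: "ks = [ks ! 0, ks ! 1]" "ks ! 0 \<in> K1t" "ks ! 1 \<in> K1t" if "ks \<in> set kss" for ks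
  proof -
    have "length ks = 2" "set ks \<subseteq> K1t" using t that kss by (auto simp: cochains_def)
    then obtain k l where "ks = [k, l]" "k \<in> K1t" "l \<in> K1t"
      by (auto simp: numeral_2_eq_2 length_Suc_conv)
    then show "ks = [ks ! 0, ks ! 1]" "ks ! 0 \<in> K1t" "ks ! 1 \<in> K1t" by simp_all
  qed
  let ?ps = "map (\<lambda>ks. (op_scale (?c ks) (ks ! 0), ks ! 1)) kss"
  have "(\<Sum>(k, l)\<leftarrow>?ps. tensor [k, l]) \<in> tensor_null"
  proof (rule tensor_square_faithful_list)
    fix a b
    have "(\<Sum>(k, l)\<leftarrow>?ps. xmult (k a) (l b)) = (\<Sum>ks\<leftarrow>kss. xscale (?c ks) (xmult ((ks ! 0) a) ((ks ! 1) b)))"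
      by (simp add: o_def op_scale_def)
    also have "\<dots> = tensor_act t a b"
      using kss by (simp add: tensor_act_def sum_list_distinct_conv_sum_set)
    finally show "(\<Sum>(k, l)\<leftarrow>?ps. xmult (k a) (l b)) = 0" by (simp add: zero)
  qed (use len(2,3) in \<open>auto intro: K1t_closed\<close>)
  moreover have "t =\<^sub>\<otimes> (\<Sum>(k, l)\<leftarrow>?ps. tensor [k, l])"
  proof -
    have "t = (\<Sum>ks\<leftarrow>kss. tscale (?c ks) (tensor ks))"
      using tens_expand[of t] kss by (simp add: sum_list_distinct_conv_sum_set)
    also have "\<dots> =\<^sub>\<otimes> (\<Sum>ks\<leftarrow>kss. tensor [op_scale (?c ks) (ks ! 0), ks ! 1])"
    proof (rule tensor_eq_sum_list, rule tensor_eq_sym)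
      fix ks assume ks: "ks \<in> set kss"
      have "tensor [op_scale (?c ks) (ks ! 0), ks ! 1] =\<^sub>\<otimes> tscale (?c ks) (tensor [ks ! 0, ks ! 1])"
        using tensor_op_scale[of "[]" "[ks ! 1]" "ks ! 0" "?c ks"] len(2,3)[OF ks] by simp
      then show "tensor [op_scale (?c ks) (ks ! 0), ks ! 1] =\<^sub>\<otimes> tscale (?c ks) (tensor ks)"
        by (simp only: len(1)[OF ks, symmetric])
    qed
    finally show ?thesis by (simp add: o_def)
  qed
  ultimately show ?thesis by (simp add: tensor_eq_null)
qed

section \<open>Coproducts and the Hochschild coboundary\<close>

lemma additive_tensor_act: "Modules.additive (\<lambda>t. tensor_act t a b)"
proof -
  have "(\<lambda>t. tensor_act t a b) = psum (\<lambda>ks c. xscale c (xmult ((ks ! 0) a) ((ks ! 1) b)))"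
    by (simp add: fun_eq_iff tensor_act_def psum_def)
  moreover have "Modules.additive (\<lambda>c. xscale c a)" for a
    by standard (auto intro!: xp_eqI simp: lookup_add algebra_simps)
  ultimately show ?thesis by (simp add: additive_psum)
qed

lemma tensor_act_tensor [simp]: "tensor_act (tensor [k, l]) a b = xmult (k a) (l b)"
  by (simp add: tensor_act_def tensor_def)

lemma cochains_add: "s \<in> cochains q \<Longrightarrow> t \<in> cochains q \<Longrightarrow> s + t \<in> cochains q"
  using Poly_Mapping.keys_add[of s t] by (auto simp: cochains_def)

lemma cochains_uminus: "t \<in> cochains q \<Longrightarrow> - t \<in> cochains q"
  by (simp add: cochains_def)

lemma cochains_diff: "s \<in> cochains q \<Longrightarrow> t \<in> cochains q \<Longrightarrow> s - t \<in> cochains q"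
  using cochains_add[OF _ cochains_uminus, of s q t] by simp

lemma cochains_tensor: "length ks = q \<Longrightarrow> set ks \<subseteq> K1t \<Longrightarrow> tensor ks \<in> cochains q"
  by (simp add: cochains_def tensor_def)

lemma coproduct_unique:
  assumes t: "t \<in> cochains 2" and act: "\<And>a b. k (xmult a b) = tensor_act t a b"
  shows "coproduct k =\<^sub>\<otimes> t"
proof -
  have "coproduct k \<in> cochains 2 \<and> (\<forall>a b. k (xmult a b) = tensor_act (coproduct k) a b)"
    unfolding coproduct_def tensor_act_def
    by (rule someI[of _ t]) (use t act in \<open>simp add: tensor_act_def\<close>)
  then have "coproduct k - t \<in> tensor_null"
    using t act by (intro tensor_square_faithful cochains_diff)
      (auto simp: Modules.additive.diff[OF additive_tensor_act])
  then show ?thesis by (simp add: tensor_eq_def)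
qed

lemma cc_op_add:
  "cc_deriv (f + g) = cc_deriv f + cc_deriv g" "cc_jet n \<phi> (f + g) = cc_jet n \<phi> f + cc_jet n \<phi> g"
  "cc_jet_inv \<phi> (f + g) = cc_jet_inv \<phi> f + cc_jet_inv \<phi> g" "cc_log \<phi> (f + g) = cc_log \<phi> f + cc_log \<phi> g"
proof -
  have "vderiv (\<lambda>x. ccf f x + ccf g x) = (\<lambda>x. vderiv (ccf f) x + vderiv (ccf g) x)"
    by (intro vderivI has_vector_derivative_add smooth_has_vderiv) simp_all
  then show "cc_deriv (f + g) = cc_deriv f + cc_deriv g"
    by (intro ccf_eqI) (simp add: plus_ccfun.rep_eq)
qed (auto intro!: ccf_eqI simp: algebra_simps)

lemma additive_ops: "Modules.additive X1" "Modules.additive (sigma_k n)"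
  "Modules.additive sigma" "Modules.additive sigma_inv" "Modules.additive log_sigma"
  by (standard; rule poly_mapping_eqI; simp add: lookup_add cc_op_add)+

lemma ops_U [simp]:
  "X1 (U f \<phi>) = U (cc_deriv f) \<phi>" "sigma_k n (U f \<phi>) = U (cc_jet n \<phi> f) \<phi>"
  "sigma (U f \<phi>) = U (cc_jet 1 \<phi> f) \<phi>"
  "sigma_inv (U f \<phi>) = U (cc_jet_inv \<phi> f) \<phi>" "log_sigma (U f \<phi>) = U (cc_log \<phi> f) \<phi>"
  by (rule poly_mapping_eqI; simp add: U_def lookup_single when_def)+

lemma K1_subset_K1t: "K1 \<subseteq> K1t"
  by (auto simp: K1t_def intro: op_algebra.gen)

lemma gens_K1t: "X1 \<in> K1t" "sigma \<in> K1t" "sigma_inv \<in> K1t" "log_sigma \<in> K1t"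
  using K1_subset_K1t by (auto simp: K1_def K1t_def intro: op_algebra.gen)

lemma vderiv_mult:
  fixes f g :: "real \<Rightarrow> 'a::real_normed_algebra"
  assumes "smooth f" "smooth g"
  shows "vderiv (\<lambda>x. f x * g x) = (\<lambda>x. f x * vderiv g x + vderiv f x * g x)"
  using assms by (intro vderivI has_vector_derivative_mult smooth_has_vderiv)

lemma vderiv_of_real:
  fixes w :: "real \<Rightarrow> real"
  assumes "smooth w"
  shows "vderiv (\<lambda>x. complex_of_real (w x)) = (\<lambda>x. of_real (vderiv w x))"
  using smooth_has_vderiv[OF assms] by (intro vderivI has_vector_derivative_of_real)
    (simp add: has_real_derivative_iff_has_vector_derivative)

lemma smooth_of_real: "smooth w \<Longrightarrow> smooth (\<lambda>x. complex_of_real (w x))"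
  using smooth_of_real_mult[of w "\<lambda>x. 1"] by simp

lemma ccf_mult_fun: "ccf (cc_mult f g) = (\<lambda>x. ccf f x * ccf g x)"
  and ccf_jet_fun: "ccf (cc_jet n \<phi> f) = (\<lambda>x. of_real ((vderiv ^^ n) (dfun \<phi>) x) * ccf f x)"
  by (simp_all add: fun_eq_iff)

lemma vderiv_pullback:
  "vderiv (ccf (cc_pullback \<phi> g)) = (\<lambda>x. of_real (vderiv (dfun \<phi>) x) * vderiv (ccf g) (dfun \<phi> x))"
  unfolding ccf_pullback_fun by (simp add: vderiv_compose scaleR_conv_of_real)

lemma cc_deriv_mult:
  "cc_deriv (cc_mult f g) = cc_mult f (cc_deriv g) + cc_mult (cc_deriv f) g"
  by (rule ccf_eqI) (simp add: ccf_mult_fun vderiv_mult)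

lemma vderiv_dcomp: "vderiv (dfun (dcomp \<psi> \<phi>)) = (\<lambda>x. vderiv (dfun \<phi>) x * vderiv (dfun \<psi>) (dfun \<phi> x))"
  unfolding dfun_dcomp_fun by (simp add: vderiv_compose)

lemma vderiv_dfun_nz [simp]: "vderiv (dfun \<phi>) x \<noteq> 0"
  using vderiv_dfun_pos[of \<phi> x] by linarith

lemma sigma_k_2: "sigma_k 2 = op_add (X1 \<circ> sigma) (op_scale (- 1) (sigma \<circ> X1))"
  by (intro ext xp_eqI) (simp add: op_add_def op_scale_def lookup_add ccf_jet_fun vderiv_mult
      vderiv_of_real smooth_of_real smooth_vderiv numeral_2_eq_2)

text \<open>The chain rule makes \<open>X1\<close> a twisted derivation,
  \<open>X1 (a b) = X1 a b + sigma a X1 b\<close>. Multiplying by the group-like \<open>sigma_inv\<close> moves the twist to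
  the right factor, where it matches the coface given by the coaction of the coefficients.\<close>

lemma coproduct_X1_twisted:
  "coproduct (sigma_inv \<circ> X1) =\<^sub>\<otimes> tensor [sigma_inv \<circ> X1, sigma_inv] + tensor [id, sigma_inv \<circ> X1]"
proof (rule coproduct_unique)
  show "tensor [sigma_inv \<circ> X1, sigma_inv] + tensor [id, sigma_inv \<circ> X1] \<in> cochains 2"
    by (intro cochains_add cochains_tensor) (auto intro: K1t_closed gens_K1t)
  show "(sigma_inv \<circ> X1) (xmult a b) =
      tensor_act (tensor [sigma_inv \<circ> X1, sigma_inv] + tensor [id, sigma_inv \<circ> X1]) a b" for a b
    unfolding Modules.additive.add[OF additive_tensor_act] tensor_act_tensor comp_apply id_apply
  proof (rule xp_biadditive_eqI[where F = "\<lambda>a b. sigma_inv (X1 (xmult a b))"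
      and G = "\<lambda>a b. xmult (sigma_inv (X1 a)) (sigma_inv b) + xmult a (sigma_inv (X1 b))"], goal_cases)
    case (5 f \<phi> g \<psi>)
    show ?case
      by (simp add: U_add[symmetric] cc_deriv_mult)
        (auto intro!: arg_cong[where f = "\<lambda>f. U f _"] ccf_eqI
          simp: vderiv_dcomp vderiv_pullback field_simps)
  qed (simp_all add: Modules.additive_def additive_ops[THEN Modules.additive.add]
      additive_xmult_left[THEN Modules.additive.add] additive_xmult_right[THEN Modules.additive.add])
qed

text \<open>\<open>sigma_inv\<close> is group-like and \<open>log_sigma\<close> is primitive, because
  \<open>ln ((\<psi> \<circ> \<phi>)') = ln \<phi>' + ln (\<psi>' \<circ> \<phi>)\<close>.\<close>

lemma coproduct_log_twisted:
  "coproduct (sigma_inv \<circ> log_sigma) =\<^sub>\<otimes>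
     tensor [sigma_inv \<circ> log_sigma, sigma_inv] + tensor [sigma_inv, sigma_inv \<circ> log_sigma]"
proof (rule coproduct_unique)
  show "tensor [sigma_inv \<circ> log_sigma, sigma_inv] + tensor [sigma_inv, sigma_inv \<circ> log_sigma] \<in> cochains 2"
    by (intro cochains_add cochains_tensor) (auto intro: K1t_closed gens_K1t)
  show "(sigma_inv \<circ> log_sigma) (xmult a b) =
      tensor_act (tensor [sigma_inv \<circ> log_sigma, sigma_inv] + tensor [sigma_inv, sigma_inv \<circ> log_sigma]) a b" for a b
    unfolding Modules.additive.add[OF additive_tensor_act] tensor_act_tensor comp_apply id_apply
  proof (rule xp_biadditive_eqI[where F = "\<lambda>a b. sigma_inv (log_sigma (xmult a b))"
      and G = "\<lambda>a b. xmult (sigma_inv (log_sigma a)) (sigma_inv b) + xmult (sigma_inv a) (sigma_inv (log_sigma b))"],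
      goal_cases)
    case (5 f \<phi> g \<psi>)
    have "ln (vderiv (dfun \<phi>) x * vderiv (dfun \<psi>) y) = ln (vderiv (dfun \<phi>) x) + ln (vderiv (dfun \<psi>) y)" for x y
      by (simp add: ln_mult)
    then show ?case
      by (simp add: U_add[symmetric])
        (auto intro!: arg_cong[where f = "\<lambda>f. U f _"] ccf_eqI
          simp: vderiv_dcomp field_simps)
  qed (simp_all add: Modules.additive_def additive_ops[THEN Modules.additive.add]
      additive_xmult_left[THEN Modules.additive.add] additive_xmult_right[THEN Modules.additive.add])
qed

lemma additive_lin_ext: "Modules.additive (lin_ext F)"
proof -
  have "lin_ext F = psum (\<lambda>ks c. tscale c (F ks))"
    by (simp add: fun_eq_iff lin_ext_def psum_def)
  moreover have "Modules.additive (\<lambda>c. tscale c t)" for t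
    by standard (rule tscale_add_left)
  ultimately show ?thesis by (simp add: additive_psum)
qed

lemma lin_ext_tensor [simp]: "lin_ext F (tensor ks) = F ks"
  by (simp add: lin_ext_def tensor_def)

lemma lin_ext_tscale: "lin_ext F (tscale c t) = tscale c (lin_ext F t)"
proof (rule additive_eqI[where F = "\<lambda>t. lin_ext F (tscale c t)" and G = "\<lambda>t. tscale c (lin_ext F t)"])
  have "lin_ext F (Poly_Mapping.single ks d) = tscale d (F ks)" for ks d
    by (simp add: lin_ext_def)
  moreover have "tscale c (Poly_Mapping.single ks d) = Poly_Mapping.single ks (c * d)" for ks d
    by (simp add: single_eq_tscale)
  ultimately show "lin_ext F (tscale c (Poly_Mapping.single ks d)) = tscale c (lin_ext F (Poly_Mapping.single ks d))" for ks d
    by simp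
qed (rule additive_comp[OF additive_lin_ext additive_tscale] additive_comp[OF additive_tscale additive_lin_ext])+

text \<open>\<open>coface\<close> applies a chosen representative of the coproduct inside a longer tensor; the
  result is well defined only up to this congruence.\<close>

lemma insert_tensor_null:
  assumes "set xs \<subseteq> K1t" "set ys \<subseteq> K1t"
  shows "t \<in> tensor_null \<Longrightarrow> lin_ext (\<lambda>ks. tensor (xs @ ks @ ys)) t \<in> tensor_null"
proof (induction rule: tensor_null.induct)
  case (rel_add xs' ys' k l)
  then show ?case
    using assms tensor_null.rel_add[of "xs @ xs'" "ys' @ ys" k l]
    by (simp add: Modules.additive.diff[OF additive_lin_ext])
next
  case (rel_scale xs' ys' k c)
  then show ?case
    using assms tensor_null.rel_scale[of "xs @ xs'" "ys' @ ys" k c]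
    by (simp add: Modules.additive.diff[OF additive_lin_ext] lin_ext_tscale)
qed (auto simp: Modules.additive.zero[OF additive_lin_ext] Modules.additive.add[OF additive_lin_ext]
    lin_ext_tscale intro: tensor_null.intros)

lemma insert_tensor_eq:
  assumes "set xs \<subseteq> K1t" "set ys \<subseteq> K1t" "s =\<^sub>\<otimes> t"
  shows "lin_ext (\<lambda>ks. tensor (xs @ ks @ ys)) s =\<^sub>\<otimes> lin_ext (\<lambda>ks. tensor (xs @ ks @ ys)) t"
  using insert_tensor_null[OF assms(1,2), of "s - t"] assms(3)
  by (simp add: tensor_eq_def Modules.additive.diff[OF additive_lin_ext])

text \<open>Write \<open>A\<close>, \<open>L\<close> for the two factors and \<open>s\<close> for \<open>sigma_inv\<close>. The six terms
  of the coboundary, \<open>1\<otimes>A\<otimes>L\<close> from \<open>d\<^sub>0\<close>, \<open>A\<otimes>s\<otimes>L + 1\<otimes>A\<otimes>L\<close> from \<open>d\<^sub>1\<close>,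
  \<open>A\<otimes>L\<otimes>s + A\<otimes>s\<otimes>L\<close> from \<open>d\<^sub>2\<close> and \<open>A\<otimes>L\<otimes>s\<close> from \<open>d\<^sub>3\<close>, cancel in pairs.\<close>

lemma hochschild_u1: "hochschild_b u1 =\<^sub>\<otimes> 0"
proof -
  let ?A = "sigma_inv \<circ> X1" and ?L = "sigma_inv \<circ> log_sigma"
  have K: "?A \<in> K1t" "?L \<in> K1t" by (auto intro: K1t_closed gens_K1t)
  have d1: "coface 1 [?A, ?L] =\<^sub>\<otimes> tensor [?A, sigma_inv, ?L] + tensor [id, ?A, ?L]"
    using insert_tensor_eq[OF _ _ coproduct_X1_twisted, of "[]" "[?L]"] K
    by (simp add: coface_def Modules.additive.add[OF additive_lin_ext])
  have d2: "coface 2 [?A, ?L] =\<^sub>\<otimes> tensor [?A, ?L, sigma_inv] + tensor [?A, sigma_inv, ?L]"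
    using insert_tensor_eq[OF _ _ coproduct_log_twisted, of "[?A]" "[]"] K
    by (simp add: coface_def Modules.additive.add[OF additive_lin_ext])
  have telescope: "a - (b + a) + (c + b) - c = 0" for a b c :: tens
    by (simp add: algebra_simps)
  have d0: "coface 0 [?A, ?L] = tensor [id, ?A, ?L]" and d3: "coface 3 [?A, ?L] = tensor [?A, ?L, sigma_inv]"
    by (simp_all add: coface_def)
  have expand: "hochschild_b u1 = coface 0 [?A, ?L] - coface 1 [?A, ?L] + coface 2 [?A, ?L] - coface 3 [?A, ?L]"
    by (simp add: hochschild_b_def u1_def numeral_2_eq_2 numeral_3_eq_3)
  have "coface 0 [?A, ?L] - coface 1 [?A, ?L] + coface 2 [?A, ?L] - coface 3 [?A, ?L] =\<^sub>\<otimes>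
      tensor [id, ?A, ?L] - (tensor [?A, sigma_inv, ?L] + tensor [id, ?A, ?L])
      + (tensor [?A, ?L, sigma_inv] + tensor [?A, sigma_inv, ?L]) - tensor [?A, ?L, sigma_inv]"
    unfolding d0 d3 by (rule tensor_eq_diff tensor_eq_add d1 d2 tensor_eq_refl)+
  then show ?thesis
    unfolding expand telescope .
qed

section \<open>A smooth bump function\<close>

lemma poly_over_exp_tendsto_0:
  fixes p :: "real poly"
  shows "((\<lambda>t. t ^ k * poly p t / exp t) \<longlongrightarrow> 0) at_top"
proof (induction p arbitrary: k)
  case (pCons a p)
  have "((\<lambda>t. a * (t ^ k / exp t) + t ^ Suc k * poly p t / exp t) \<longlongrightarrow> a * 0 + 0) at_top"
    by (intro tendsto_add tendsto_mult tendsto_const tendsto_power_div_exp_0 pCons.IH)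
  then show ?case by (simp add: algebra_simps add_divide_distrib)
qed simp

text \<open>For \<open>p = 1\<close> this is the standard smooth function that vanishes exactly on the left half
  line. The polynomial factor makes the family closed under differentiation, so smoothness follows
  by induction on the order of the derivative.\<close>

definition flat_exp :: "real poly \<Rightarrow> real \<Rightarrow> real" where
  "flat_exp p x = (if x \<le> 0 then 0 else poly p (inverse x) * exp (- inverse x))"

lemma flat_exp_has_derivative:
  "(flat_exp p has_vector_derivative flat_exp ([:0, 0, 1:] * (p - pderiv p)) x) (at x)"
proof -
  let ?q = "[:0, 0, 1:] * (p - pderiv p)"
  consider "x < 0" | "x = 0" | "x > 0" by linarith
  then have "(flat_exp p has_real_derivative flat_exp ?q x) (at x)"
  proof cases
    case 1
    have "((\<lambda>x. 0) has_real_derivative 0) (at x)" by simp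
    then have "(flat_exp p has_real_derivative 0) (at x)"
      by (rule has_field_derivative_transform_within_open[where S = "{..<0}"])
        (use 1 in \<open>auto simp: flat_exp_def\<close>)
    then show ?thesis using 1 by (simp add: flat_exp_def)
  next
    case 2
    have "((\<lambda>y. flat_exp p y / y) \<longlongrightarrow> 0) (at_left 0)"
      by (rule tendsto_eventually) (auto simp: eventually_at_filter flat_exp_def)
    moreover have "((\<lambda>y. flat_exp p y / y) \<longlongrightarrow> 0) (at_right 0)"
    proof (rule Lim_transform_eventually)
      show "((\<lambda>y. inverse y ^ 1 * poly p (inverse y) / exp (inverse y)) \<longlongrightarrow> 0) (at_right (0::real))"
        by (rule filterlim_compose[OF poly_over_exp_tendsto_0 filterlim_inverse_at_top_right])
      show "\<forall>\<^sub>F y in at_right 0. inverse y ^ 1 * poly p (inverse y) / exp (inverse y) = flat_exp p y / y"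
        by (auto simp: eventually_at_filter flat_exp_def exp_minus field_simps)
    qed
    ultimately have "((\<lambda>y. flat_exp p y / y) \<longlongrightarrow> 0) (at 0)"
      by (simp add: filterlim_split_at)
    then show ?thesis using 2
      by (simp add: has_field_derivative_iff flat_exp_def[of _ 0])
  next
    case 3
    have "((\<lambda>x. poly p (inverse x) * exp (- inverse x)) has_real_derivative
        poly ?q (inverse x) * exp (- inverse x)) (at x)"
      using 3 by (auto intro!: derivative_eq_intros poly_DERIV DERIV_chain2[OF poly_DERIV, unfolded o_def]
          simp: field_simps power2_eq_square)
    then have "(flat_exp p has_real_derivative poly ?q (inverse x) * exp (- inverse x)) (at x)"
      by (rule has_field_derivative_transform_within_open[where S = "{0<..}"])
        (use 3 in \<open>auto simp: flat_exp_def\<close>)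
    then show ?thesis using 3 by (simp add: flat_exp_def)
  qed
  then show ?thesis by (simp add: has_real_derivative_iff_has_vector_derivative)
qed

lemma smooth_flat_exp: "smooth (flat_exp p)"
proof -
  have "cdiff n (flat_exp p)" for n
    by (induction n arbitrary: p) (auto intro: cdiff_SucI[OF flat_exp_has_derivative])
  then show ?thesis by (simp add: smooth_iff_cdiff)
qed

lemma smooth_affine: "smooth (\<lambda>x::real. a * x + b)"
  by (intro smooth_add smooth_mult smooth_const smooth_ident)

lemma smooth_shift: "smooth f \<Longrightarrow> smooth (\<lambda>x. f (x + s))" for f :: "real \<Rightarrow> 'a::real_normed_vector"
  by (rule smooth_compose) (auto intro: smooth_add smooth_ident)

definition smooth_step :: "real \<Rightarrow> real" where
  "smooth_step x = flat_exp 1 x * inverse (flat_exp 1 x + flat_exp 1 (1 - x))"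

lemma smooth_smooth_step: "smooth smooth_step"
proof -
  have "smooth (\<lambda>x. flat_exp 1 (1 - x))"
    using smooth_compose[OF smooth_flat_exp smooth_affine[of "-1" 1]] by simp
  moreover have "flat_exp 1 x + flat_exp 1 (1 - x) \<noteq> 0" for x
    by (cases "x \<le> 0") (auto simp: flat_exp_def add_pos_pos less_imp_neq[THEN not_sym])
  ultimately show ?thesis
    unfolding smooth_step_def by (intro smooth_mult smooth_inverse smooth_add smooth_flat_exp)
qed

lemma smooth_step_eq_0: "x \<le> 0 \<Longrightarrow> smooth_step x = 0"
  by (simp add: smooth_step_def flat_exp_def)

lemma smooth_step_eq_1: "x \<ge> 1 \<Longrightarrow> smooth_step x = 1"
  by (simp add: smooth_step_def flat_exp_def)

text \<open>The counit is a definite description quantified over functions equal to \<open>1\<close> near a point;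
  it is meaningful only because such functions exist.\<close>

lemma ex_bump: "\<exists>f. \<forall>\<^sub>F y in nhds 0. ccf f y = 1"
proof -
  \<comment> \<open>Supported in \<open>[-2, 2]\<close> and equal to \<open>1\<close> on \<open>[-1, 1]\<close>.\<close>
  let ?w = "\<lambda>x. smooth_step (x + 2) * smooth_step (- x + 2)"
  have w: "smooth ?w"
    using smooth_compose[OF smooth_smooth_step smooth_affine[of "-1" 2]]
    by (intro smooth_mult smooth_shift smooth_smooth_step) simp
  have "smooth (\<lambda>x. complex_of_real (?w x) * 1)"
    by (intro smooth_of_real_mult w smooth_const)
  moreover have "compactly_supported (\<lambda>x. complex_of_real (?w x) * 1)"
    unfolding compactly_supported_def
    by (intro exI[of _ "{-2..2}"]) (auto simp: not_le smooth_step_eq_0)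
  ultimately have *: "ccf (Abs_ccfun (\<lambda>x. complex_of_real (?w x) * 1)) = (\<lambda>x. complex_of_real (?w x) * 1)"
    by (simp add: Abs_ccfun_inverse)
  have "\<forall>\<^sub>F y in nhds (0::real). y \<in> {-1<..<1}"
    by (rule eventually_nhds_in_open) auto
  then have "\<forall>\<^sub>F y in nhds 0. ccf (Abs_ccfun (\<lambda>x. complex_of_real (?w x) * 1)) y = 1"
    unfolding * by eventually_elim (auto simp: smooth_step_eq_1)
  then show ?thesis by blast
qed

section \<open>The counit and normalization\<close>

lemma counit_eqI:
  assumes "\<And>f x. \<forall>\<^sub>F y in nhds x. ccf f y = 1 \<Longrightarrow> ccf (Poly_Mapping.lookup (k (U f did)) did) x = c"
  shows "counit k = c"
  unfolding counit_def
proof (rule the_equality)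
  fix d assume d: "\<forall>f x. (\<forall>\<^sub>F y in nhds x. ccf f y = 1) \<longrightarrow>
     ccf (Poly_Mapping.lookup (k (U f did)) did) x = d"
  obtain f where "\<forall>\<^sub>F y in nhds 0. ccf f y = 1" using ex_bump by blast
  then show "d = c" using assms d by metis
qed (use assms in blast)

lemma dfun_did_fun: "dfun did = (\<lambda>x. x)"
  by (simp add: fun_eq_iff)

lemma vderiv_const: "vderiv (\<lambda>x. c) = (\<lambda>x. 0)"
  by (rule vderivI) simp

lemma counit_X1_twisted: "counit (sigma_inv \<circ> X1) = 0"
proof (rule counit_eqI)
  fix f x assume "\<forall>\<^sub>F y in nhds x. ccf f y = 1"
  then obtain S where S: "open S" "x \<in> S" "\<And>y. y \<in> S \<Longrightarrow> ccf f y = 1"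
    by (auto simp: eventually_nhds)
  have "((\<lambda>x. 1) has_vector_derivative 0) (at x)" by simp
  then have "(ccf f has_vector_derivative 0) (at x)"
    by (rule has_vector_derivative_transform_within_open) (use S in auto)
  then have "vderiv (ccf f) x = 0" by (simp add: vderiv_def vector_derivative_at)
  then show "ccf (Poly_Mapping.lookup ((sigma_inv \<circ> X1) (U f did)) did) x = 0"
    by (simp add: U_def)
qed

lemma counit_log_twisted: "counit (sigma_inv \<circ> log_sigma) = 0"
  by (rule counit_eqI) (simp add: U_def dfun_did_fun vderiv_ident)

lemma cc_jet_2_did: "cc_jet 2 did f = 0"
  by (rule ccf_eqI) (simp add: dfun_did_fun vderiv_ident numeral_2_eq_2 vderiv_const)

lemma counit_c1: "counit (sigma_inv \<circ> sigma_inv \<circ> sigma_k 2) = 0"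
  by (rule counit_eqI) (simp add: cc_jet_2_did)

lemma tau_0 [simp]: "tau 0 = 0"
  by (simp add: tau_def)

lemma chi_tau_tensor [simp]:
  "chi_tau (tensor ks) as = utau (foldl umult (hd as) (map2 uact ks (tl as)))"
  by (simp add: chi_tau_def tensor_def)

lemma ops_zero [simp]: "X1 0 = 0" "sigma_k n 0 = 0" "sigma_inv 0 = 0" "log_sigma 0 = 0"
  by (rule additive_ops[THEN Modules.additive.zero])+

text \<open>Both factors of \<open>u1\<close> have counit \<open>0\<close>, hence annihilate the unit.\<close>

lemma normalized_u1: "normalized2 (chi_tau u1)"
  unfolding normalized2_def u1_def
  by (auto simp: uact_def uone_def umult_def utau_def counit_X1_twisted counit_log_twisted)

section \<open>Integration of compactly supported functions\<close>

definition cc_integral :: "ccfun \<Rightarrow> complex" where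
  "cc_integral f = (LINT x|lborel. ccf f x)"

lemma smooth_continuous_on: "smooth f \<Longrightarrow> continuous_on S f"
  using smooth_has_vderiv[of f]
  by (intro continuous_at_imp_continuous_on ballI has_vector_derivative_continuous)

lemma ccf_support: "\<exists>r>0. \<forall>x. x \<notin> {- r<..<r} \<longrightarrow> ccf f x = 0"
proof -
  obtain K where K: "compact K" "\<And>x. x \<notin> K \<Longrightarrow> ccf f x = 0"
    using ccf_compactly_supported[of f] by (auto simp: compactly_supported_def)
  obtain r where r: "r > 0" "\<And>x. x \<in> K \<Longrightarrow> norm x < r"
    using compact_imp_bounded[OF K(1)] by (auto simp: bounded_pos_less)
  show ?thesis using K(2) r by (intro exI[of _ r]) force
qed

lemma ccf_eq_indicator:
  assumes "\<And>x. x \<notin> {a..b} \<Longrightarrow> ccf f x = 0"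
  shows "ccf f = (\<lambda>x. indicator {a..b} x *\<^sub>R ccf f x)"
  using assms by (auto simp: fun_eq_iff indicator_def)

lemma cc_integral_eq_Icc:
  assumes "\<And>x. x \<notin> {a..b} \<Longrightarrow> ccf f x = 0"
  shows "cc_integral f = (LBINT x:{a..b}. ccf f x)"
  by (subst ccf_eq_indicator[OF assms]; (simp add: cc_integral_def set_lebesgue_integral_def)?)
    (use assms in \<open>auto simp: indicator_def intro!: Bochner_Integration.integral_cong\<close>)

lemma integrable_ccf [simp]: "integrable lborel (ccf f)"
proof -
  obtain r where "\<And>x. x \<notin> {- r<..<r} \<Longrightarrow> ccf f x = 0" using ccf_support by blast
  then have "ccf f = (\<lambda>x. indicator {- r..r} x *\<^sub>R ccf f x)"
    by (intro ccf_eq_indicator) auto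
  moreover have "integrable lborel (\<lambda>x. indicator {- r..r} x *\<^sub>R ccf f x)"
    by (intro borel_integrable_compact compact_Icc smooth_continuous_on ccf_smooth)
  ultimately show ?thesis by simp
qed

lemma cc_integral_simps [simp]:
  "cc_integral 0 = 0"
  "cc_integral (f + g) = cc_integral f + cc_integral g" "cc_integral (f - g) = cc_integral f - cc_integral g"
  "cc_integral (- f) = - cc_integral f"
  "cc_integral (cc_scale c f) = c * cc_integral f"
  by (simp_all add: cc_integral_def)

lemma cc_integral_deriv [simp]: "cc_integral (cc_deriv f) = 0"
proof -
  obtain r where r: "r > 0" "\<And>x. x \<notin> {- r<..<r} \<Longrightarrow> ccf f x = 0" using ccf_support by blast
  obtain r' where r': "r' > 0" "\<And>x. x \<notin> {- r'<..<r'} \<Longrightarrow> ccf (cc_deriv f) x = 0" using ccf_support by blast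
  let ?R = "max r r'"
  have "cc_integral (cc_deriv f) = (LBINT x:{- ?R..?R}. ccf (cc_deriv f) x)"
    by (rule cc_integral_eq_Icc, rule r'(2)) auto
  also have "\<dots> = ccf f ?R - ccf f (- ?R)"
    unfolding set_lebesgue_integral_def
  proof (rule integral_FTC_atLeastAtMost)
    show "(ccf f has_vector_derivative ccf (cc_deriv f) x) (at x within {- ?R..?R})" for x
      using smooth_has_vderiv[OF ccf_smooth[of f]] by (auto intro: has_vector_derivative_at_within)
  qed (use r(1) in \<open>auto intro!: smooth_continuous_on smooth_vderiv\<close>)
  also have "\<dots> = 0" using r(2)[of ?R] r(2)[of "- ?R"] by simp
  finally show ?thesis .
qed

lemma dfun_less_iff: "dfun \<phi> x < dfun \<phi> y \<longleftrightarrow> x < y"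
proof -
  have less: "dfun \<phi> x < dfun \<phi> y" if "x < y" for x y
  proof (rule DERIV_pos_imp_increasing[OF that])
    show "\<exists>d. (dfun \<phi> has_real_derivative d) (at z) \<and> d > 0" for z
      using smooth_has_vderiv[OF dfun_smooth[of \<phi>], of z] vderiv_dfun_pos[of \<phi> z]
      unfolding has_real_derivative_iff_has_vector_derivative by blast
  qed
  show ?thesis using less[of x y] less[of y x] by (cases x y rule: linorder_cases) auto
qed

text \<open>Invariance of the integral under \<open>\<phi>\<close>, which makes \<open>sigma\<close> the modular operator of \<open>tau\<close>:
  in the boundary it brings the two integrals to a common variable.\<close>

lemma cc_integral_substitution:
  "cc_integral (cc_jet 1 \<phi> (cc_pullback \<phi> h)) = cc_integral h"
proof -
  obtain r where r: "r > 0" "\<And>x. x \<notin> {- r<..<r} \<Longrightarrow> ccf h x = 0" using ccf_support by blast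
  have "surj (dfun \<phi>)" by (rule bij_is_surj[OF dfun_bij])
  then obtain p q where pq: "- r = dfun \<phi> p" "r = dfun \<phi> q" by (meson surjD)
  have "p < q" using dfun_less_iff[of \<phi> p q] pq r(1) by simp
  \<comment> \<open>\<open>\<phi>\<close> is increasing, so the preimage of an interval carrying \<open>h\<close> carries \<open>h \<circ> \<phi>\<close>.\<close>
  have out: "ccf h (dfun \<phi> x) = 0" if "x \<notin> {p..q}" for x
    using that pq dfun_less_iff[of \<phi> x p] dfun_less_iff[of \<phi> q x] by (intro r(2)) auto
  have "cc_integral (cc_jet 1 \<phi> (cc_pullback \<phi> h))
      = (LBINT x:{p..q}. ccf (cc_jet 1 \<phi> (cc_pullback \<phi> h)) x)"
    by (rule cc_integral_eq_Icc) (simp add: out)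
  also have "\<dots> = (LBINT x=p..q. vderiv (dfun \<phi>) x *\<^sub>R ccf h (dfun \<phi> x))"
    using \<open>p < q\<close> by (simp add: interval_integral_Icc scaleR_conv_of_real)
  also have "\<dots> = (LBINT y=dfun \<phi> p..dfun \<phi> q. ccf h y)"
  proof (rule interval_integral_substitution_finite)
    show "(dfun \<phi> has_real_derivative vderiv (dfun \<phi>) x) (at x within {p..q})" for x
      using smooth_has_vderiv[OF dfun_smooth[of \<phi>]]
      by (auto simp: has_real_derivative_iff_has_vector_derivative intro: has_vector_derivative_at_within)
  qed (use \<open>p < q\<close> in \<open>auto intro!: smooth_continuous_on smooth_vderiv\<close>)
  also have "\<dots> = (LBINT y:{- r..r}. ccf h y)"
    using r(1) by (simp add: pq[symmetric] interval_integral_Icc)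
  also have "\<dots> = cc_integral h"
    by (rule cc_integral_eq_Icc[symmetric], rule r(2)) auto
  finally show ?thesis .
qed

lemma tau_cc_integral: "tau a = cc_integral (Poly_Mapping.lookup a did)"
  by (simp add: tau_def cc_integral_def)

lemma additive_tau: "Modules.additive tau"
  by standard (simp add: tau_cc_integral lookup_add)

lemma tau_xscale [simp]: "tau (xscale c a) = c * tau a"
  by (simp add: tau_cc_integral)

lemma tau_U: "tau (U f \<phi>) = (if \<phi> = did then cc_integral f else 0)"
  by (simp add: tau_cc_integral U_def lookup_single)

section \<open>Connes' boundary of the cocycle\<close>

lemma dcomp_did_commute: "dcomp \<psi> \<phi> = did \<longleftrightarrow> dcomp \<phi> \<psi> = did"
proof -
  have "dcomp \<phi> \<psi> = did" if "dcomp \<psi> \<phi> = did" for \<phi> \<psi>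
  proof (rule diffeo_eqI)
    fix y
    have "surj (dfun \<phi>)" by (rule bij_is_surj[OF dfun_bij])
    then obtain x where y: "y = dfun \<phi> x" by (meson surjD)
    have "dfun \<psi> (dfun \<phi> x) = x" using arg_cong[OF that, of "\<lambda>\<theta>. dfun \<theta> x"] by simp
    then show "dfun (dcomp \<phi> \<psi>) y = dfun did y" by (simp add: y)
  qed
  then show ?thesis by blast
qed

text \<open>Differentiate \<open>\<psi>(\<phi>(x)) = x\<close> once and twice.\<close>

lemma inverse_jets:
  assumes "dcomp \<psi> \<phi> = did"
  shows "dfun \<psi> (dfun \<phi> x) = x"
    and "vderiv (dfun \<psi>) (dfun \<phi> x) = inverse (vderiv (dfun \<phi>) x)"
    and "(vderiv ^^ 2) (dfun \<psi>) (dfun \<phi> x) = - (vderiv ^^ 2) (dfun \<phi>) x / vderiv (dfun \<phi>) x ^ 3"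
proof -
  let ?w = "vderiv (dfun \<phi>)"
  show "dfun \<psi> (dfun \<phi> x) = x" using arg_cong[OF assms, of "\<lambda>\<theta>. dfun \<theta> x"] by simp
  have 1: "?w x * vderiv (dfun \<psi>) (dfun \<phi> x) = 1" for x
    using arg_cong[OF assms, of "\<lambda>\<theta>. vderiv (dfun \<theta>) x"] by (simp add: vderiv_dcomp dfun_did_fun vderiv_ident)
  show "vderiv (dfun \<psi>) (dfun \<phi> x) = inverse (?w x)"
    using inverse_unique[OF 1[of x]] by simp
  have "vderiv (\<lambda>x. ?w x * vderiv (dfun \<psi>) (dfun \<phi> x)) x
      = ?w x * (?w x * vderiv (vderiv (dfun \<psi>)) (dfun \<phi> x)) + vderiv ?w x * vderiv (dfun \<psi>) (dfun \<phi> x)"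
    by (simp add: vderiv_mult vderiv_compose smooth_compose smooth_vderiv)
  then have "?w x * (?w x * vderiv (vderiv (dfun \<psi>)) (dfun \<phi> x)) + vderiv ?w x * inverse (?w x) = 0"
    by (simp add: 1 vderiv_const inverse_unique[OF 1])
  then show "(vderiv ^^ 2) (dfun \<psi>) (dfun \<phi> x) = - (vderiv ^^ 2) (dfun \<phi>) x / ?w x ^ 3"
    by (simp add: numeral_2_eq_2 field_simps power3_eq_cube)
qed

text \<open>Transport the second integral to the variable of the first one. With \<open>w = \<phi>'\<close> and
  \<open>h = f (g \<circ> \<phi>)\<close> the two integrands on the left combine to \<open>- h' ln w\<close>, the one on the right is
  \<open>h w' / w\<close>, and the two sides differ by the integral of the derivative of \<open>h ln w\<close>.
  The sign of the second jet of \<open>\<psi>\<close> is what makes the boundary \<open>- c1K\<close>.\<close>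

lemma trace_identity_on_terms:
  assumes inv: "dcomp \<psi> \<phi> = did"
  shows "cc_integral (cc_mult (cc_jet_inv \<phi> (cc_deriv f)) (cc_pullback \<phi> (cc_jet_inv \<psi> (cc_log \<psi> g))))
      - cc_integral (cc_mult (cc_jet_inv \<psi> (cc_deriv g)) (cc_pullback \<psi> (cc_jet_inv \<phi> (cc_log \<phi> f))))
      = - cc_integral (cc_mult f (cc_pullback \<phi> (cc_jet_inv \<psi> (cc_jet_inv \<psi> (cc_jet 2 \<psi> g)))))"
    (is "cc_integral ?t1 - cc_integral ?t2 = - cc_integral ?t3")
proof -
  let ?P = "cc_log \<phi> (cc_mult f (cc_pullback \<phi> g))"
  let ?w = "vderiv (dfun \<phi>)"
  have "?t1 - cc_jet 1 \<phi> (cc_pullback \<phi> ?t2) + ?t3 = - cc_deriv ?P"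
  proof (rule ccf_eqI)
    fix x
    have lnw: "smooth (\<lambda>x. ln (?w x))"
      by (intro smooth_ln smooth_vderiv dfun_smooth vderiv_dfun_pos)
    have dlnw: "vderiv (\<lambda>x. ln (?w x)) = (\<lambda>x. (vderiv ^^ 2) (dfun \<phi>) x / ?w x)"
      using smooth_has_vderiv[OF smooth_vderiv[OF dfun_smooth[of \<phi>]]]
      by (intro vderivI) (auto simp: has_real_derivative_iff_has_vector_derivative[symmetric] numeral_2_eq_2 field_simps
          intro!: derivative_eq_intros)
    have P: "ccf ?P = (\<lambda>x. of_real (ln (?w x)) * ccf (cc_mult f (cc_pullback \<phi> g)) x)"
      by (simp add: fun_eq_iff)
    have "vderiv (ccf ?P) x = of_real (ln (?w x)) * vderiv (ccf (cc_mult f (cc_pullback \<phi> g))) x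
        + of_real ((vderiv ^^ 2) (dfun \<phi>) x / ?w x) * ccf (cc_mult f (cc_pullback \<phi> g)) x"
      unfolding P by (subst vderiv_mult) (simp_all add: smooth_of_real lnw vderiv_of_real dlnw)
    moreover have "vderiv (ccf (cc_mult f (cc_pullback \<phi> g))) x
        = ccf f x * (of_real (?w x) * vderiv (ccf g) (dfun \<phi> x)) + vderiv (ccf f) x * ccf g (dfun \<phi> x)"
      unfolding ccf_mult_fun by (subst vderiv_mult) (simp_all add: vderiv_pullback)
    moreover have "?w x \<noteq> 0" "ln (1 / ?w x) = - ln (?w x)" by (simp_all add: ln_div)
    ultimately show "ccf (?t1 - cc_jet 1 \<phi> (cc_pullback \<phi> ?t2) + ?t3) x = ccf (- cc_deriv ?P) x"
      by (simp add: inverse_jets[OF inv] field_simps power3_eq_cube del: vderiv_dfun_nz)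
  qed
  from arg_cong[OF this, of cc_integral] show ?thesis
    by (simp add: cc_integral_substitution[unfolded One_nat_def] eq_neg_iff_add_eq_0)
qed

text \<open>If \<open>\<phi>\<close> and \<open>\<psi>\<close> are not inverse to each other, neither product has a component at the
  identity and all three traces vanish.\<close>

lemma trace_identity:
  "tau (xmult (sigma_inv (X1 a)) (sigma_inv (log_sigma b))) - tau (xmult (sigma_inv (X1 b)) (sigma_inv (log_sigma a)))
    = - tau (xmult a (sigma_inv (sigma_inv (sigma_k 2 b))))"
proof (rule xp_biadditive_eqI[where
    F = "\<lambda>a b. tau (xmult (sigma_inv (X1 a)) (sigma_inv (log_sigma b))) - tau (xmult (sigma_inv (X1 b)) (sigma_inv (log_sigma a)))"
    and G = "\<lambda>a b. - tau (xmult a (sigma_inv (sigma_inv (sigma_k 2 b))))"], goal_cases)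
  case (5 f \<phi> g \<psi>)
  show ?case
    using trace_identity_on_terms[of \<psi> \<phi> f g] dcomp_did_commute[of \<psi> \<phi>] by (simp add: tau_U)
qed (simp_all add: Modules.additive_def additive_ops[THEN Modules.additive.add]
    additive_xmult_left[THEN Modules.additive.add] additive_xmult_right[THEN Modules.additive.add]
    additive_tau[THEN Modules.additive.add])

lemma additive_chi_tau: "Modules.additive (\<lambda>t. chi_tau t as)"
proof -
  have "(\<lambda>t. chi_tau t as) = psum (\<lambda>ks c. c * utau (foldl umult (hd as) (map2 uact ks (tl as))))"
    by (simp add: fun_eq_iff chi_tau_def psum_def)
  moreover have "Modules.additive (\<lambda>c. c * z)" for z :: complex
    by standard (simp add: algebra_simps)
  ultimately show ?thesis by (simp add: additive_psum)
qed

text \<open>Only the component at the identity diffeomorphism counts, and there the second jet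
  vanishes. This disposes of the scalar part of the unitization.\<close>

lemma tau_c1: "tau (sigma_inv (sigma_inv (sigma_k 2 b))) = 0"
  by (simp add: tau_cc_integral cc_jet_2_did)

text \<open>The counits vanish, so the scalar parts of the arguments drop out and the identity of
  traces on the crossed product itself remains.\<close>

lemma connes_B_u1: "connes_B (chi_tau u1) a b = chi_tau (- c1K) [a, b]"
proof -
  have "connes_B (chi_tau u1) a b = tau (xmult (sigma_inv (X1 (snd a))) (sigma_inv (log_sigma (snd b))))
      - tau (xmult (sigma_inv (X1 (snd b))) (sigma_inv (log_sigma (snd a))))"
    by (simp add: connes_B_def u1_def uact_def uone_def umult_def utau_def counit_X1_twisted counit_log_twisted)
  also have "\<dots> = - tau (xmult (snd a) (sigma_inv (sigma_inv (sigma_k 2 (snd b)))))"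
    by (rule trace_identity)
  also have "\<dots> = chi_tau (- c1K) [a, b]"
    unfolding Modules.additive.minus[OF additive_chi_tau]
    by (simp add: c1K_def uact_def umult_def utau_def counit_c1 tau_c1 additive_tau[THEN Modules.additive.add])
  finally show ?thesis .
qed

section \<open>Uniqueness of the boundary\<close>

lift_definition dinv :: "diffeo \<Rightarrow> diffeo" is inv
proof -
  fix \<phi> :: "real \<Rightarrow> real"
  assume a: "bij \<phi> \<and> smooth \<phi> \<and> smooth (inv \<phi>) \<and> (\<forall>x. vderiv \<phi> x > 0)"
  have "(\<lambda>y. \<phi> (inv \<phi> y)) = (\<lambda>y. y)" using a by (simp add: bij_is_surj surj_f_inv_f)
  then have "vderiv (inv \<phi>) y * vderiv \<phi> (inv \<phi> y) = 1" for y
    using vderiv_compose[of \<phi> "inv \<phi>"] a by (simp add: vderiv_ident fun_eq_iff)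
  then have "vderiv (inv \<phi>) y > 0" for y
    using a by (metis zero_less_mult_pos2 zero_less_one)
  then show "bij (inv \<phi>) \<and> smooth (inv \<phi>) \<and> smooth (inv (inv \<phi>)) \<and> (\<forall>x. vderiv (inv \<phi>) x > 0)"
    using a by (simp add: bij_imp_bij_inv inv_inv_eq)
qed

lemma dcomp_dinv: "dcomp \<psi> (dinv \<psi>) = did"
  using dfun_bij[of \<psi>] by (intro diffeo_eqI) (simp add: dinv.rep_eq bij_is_surj surj_f_inv_f)

lemma smooth_cnj:
  assumes "smooth f"
  shows "smooth (\<lambda>x. cnj (f x))"
proof -
  have "cdiff n f \<Longrightarrow> cdiff n (\<lambda>x. cnj (f x))" for n
  proof (induction n arbitrary: f)
    case (Suc n)
    show ?case
    proof (rule cdiff_SucI)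
      show "((\<lambda>x. cnj (f x)) has_vector_derivative cnj (vderiv f x)) (at x)" for x
        by (rule bounded_linear.has_vector_derivative[OF bounded_linear_cnj cdiff_has_vderiv[OF Suc.prems]])
      show "cdiff n (\<lambda>x. cnj (vderiv f x))"
        by (rule Suc.IH[OF cdiff_Suc_vderiv[OF Suc.prems]])
    qed
  qed simp
  then show ?thesis using assms by (simp add: smooth_iff_cdiff)
qed

lift_definition cc_cnj :: "ccfun \<Rightarrow> ccfun" is "\<lambda>f x. cnj (f x)"
  by (auto simp: smooth_cnj compactly_supported_def)

text \<open>\<open>|h|\<^sup>2\<close> is continuous with integral \<open>0\<close>.\<close>

lemma cc_integral_norm_eq_0:
  assumes "cc_integral (cc_mult (cc_cnj h) h) = 0"
  shows "h = 0"
proof (rule ccf_eqI)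
  fix x
  let ?F = "\<lambda>x. (norm (ccf h x))\<^sup>2"
  have F: "ccf (cc_mult (cc_cnj h) h) = (\<lambda>x. complex_of_real (?F x))"
    by (simp only: fun_eq_iff ccf_simps cc_cnj.rep_eq complex_norm_square mult.commute) simp
  have "integrable lborel (\<lambda>x. complex_of_real (?F x))"
    using integrable_ccf[of "cc_mult (cc_cnj h) h"] by (simp only: F)
  then have int: "integrable lborel ?F"
    using integrable_Re by fastforce
  have "integral\<^sup>L lborel ?F = 0"
    using assms unfolding cc_integral_def F integral_complex_of_real by simp
  then have "AE x in lborel. ?F x = 0"
    using integral_nonneg_eq_0_iff_AE[OF int] by simp
  then have "AE x in lebesgue. x \<in> {x. ccf h x = 0}"
    by (intro AE_completion) auto
  moreover have "closed {x. ccf h x = 0}"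
    using smooth_continuous_on[OF ccf_smooth[of h], of UNIV]
    by (intro closed_Collect_eq continuous_on_const) auto
  ultimately have "x \<in> {x. ccf h x = 0}"
    by (rule mem_closed_if_AE_lebesgue[rotated])
  then show "ccf h x = ccf 0 x" by simp
qed

text \<open>Pair \<open>k (U g \<psi>)\<close> with the conjugate of its own coefficient at the inverse of \<open>\<psi>\<close>: the
  trace is then the square of an \<open>L\<^sup>2\<close> norm.\<close>

lemma trace_faithful:
  assumes k: "natural_op k" and zero: "\<And>a b. tau (xmult a (k b)) = 0"
  shows "k = (\<lambda>a. 0)"
proof (rule natural_op_eqI[OF k natural_op_K1t[OF zero_op_K1t]])
  fix \<psi> g y
  let ?h = "cc_pullback (dinv \<psi>) (component k \<psi> g)"
  have "tau (xmult (U (cc_cnj ?h) (dinv \<psi>)) (k (U g \<psi>))) = 0" by (rule zero)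
  then have "cc_integral (cc_mult (cc_cnj ?h) ?h) = 0"
    unfolding natural_op_component(2)[OF k] xmult_U dcomp_dinv by (simp add: tau_U)
  then have "?h = 0" by (rule cc_integral_norm_eq_0)
  then have "ccf ?h (dfun \<psi> y) = 0" by simp
  then have "ccf (component k \<psi> g) y = 0"
    using dfun_bij[of \<psi>] by (simp add: dinv.rep_eq bij_is_inj inv_f_f)
  then show "ccf (component k \<psi> g) y = ccf (component (\<lambda>a. 0) \<psi> g) y"
    by (simp add: component_def)
qed

text \<open>By multilinearity a 1-cochain equals the tensor of a single operator, and arguments without scalar part
  already pair it faithfully with the trace.\<close>

lemma chi_tau_injective:
  assumes t: "t \<in> cochains 1" and zero: "\<And>a b. chi_tau t [a, b] = 0"
  shows "t \<in> tensor_null"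
proof -
  obtain kss where kss: "set kss = Poly_Mapping.keys t" "distinct kss"
    using finite_distinct_list[OF Poly_Mapping.finite_keys[of t]] by blast
  let ?c = "Poly_Mapping.lookup t"
  have len: "\<exists>k. ks = [k] \<and> k \<in> K1t" if "ks \<in> set kss" for ks
  proof -
    have "length ks = 1" "set ks \<subseteq> K1t" using t that kss by (auto simp: cochains_def)
    then show ?thesis by (auto simp: length_Suc_conv)
  qed
  let ?k = "lincomb ?c hd kss"
  have hd_K1t: "hd ks \<in> K1t" if "ks \<in> set kss" for ks using len[OF that] by auto
  have "tau (xmult a (?k b)) = 0" for a b
  proof -
    have "tau (xmult a (lincomb ?c hd rs b)) = (\<Sum>ks\<leftarrow>rs. ?c ks * tau (xmult a (hd ks b)))" for rs
      by (induction rs) (simp_all add: lincomb_apply Modules.additive.add[OF additive_xmult_right]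
          Modules.additive.add[OF additive_tau])
    then have "tau (xmult a (?k b)) = (\<Sum>ks\<in>Poly_Mapping.keys t. ?c ks * tau (xmult a (hd ks b)))"
      using kss by (simp add: sum_list_distinct_conv_sum_set)
    also have "\<dots> = chi_tau t [(0, a), (0, b)]"
      unfolding chi_tau_def
    proof (intro sum.cong refl arg_cong2[where f = "(*)"])
      fix ks assume "ks \<in> Poly_Mapping.keys t"
      then obtain k where "ks = [k]" using len kss by blast
      then show "tau (xmult a (hd ks b)) =
          utau (foldl umult (hd [(0, a), (0, b)]) (map2 uact ks (tl [(0, a), (0, b)])))"
        by (simp add: uact_def umult_def utau_def)
    qed
    finally show ?thesis by (simp add: zero)
  qed
  then have "?k = (\<lambda>a. 0)"
    by (intro trace_faithful natural_op_K1t lincomb_K1t hd_K1t)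
  then have "tensor [?k] \<in> tensor_null" using tensor_zero_op[of "[]" "[]"] by simp
  moreover have "tensor [?k] =\<^sub>\<otimes> (\<Sum>ks\<leftarrow>kss. tscale (?c ks) (tensor [hd ks]))"
    using tensor_lincomb[of "[]" "[]" kss hd ?c] hd_K1t by simp
  moreover have "(\<Sum>ks\<leftarrow>kss. tscale (?c ks) (tensor [hd ks])) = t"
  proof -
    have "(\<Sum>ks\<leftarrow>kss. tscale (?c ks) (tensor [hd ks])) = (\<Sum>ks\<leftarrow>kss. tscale (?c ks) (tensor ks))"
      using len by (intro arg_cong[where f = sum_list] map_cong refl) fastforce
    also have "\<dots> = t"
      using tens_expand[of t, symmetric] kss by (simp add: sum_list_distinct_conv_sum_set)
    finally show ?thesis .
  qed
  ultimately show ?thesis by (simp add: tensor_eq_null)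
qed

lemma c1K_cochain: "c1K \<in> cochains 1"
  unfolding c1K_def sigma_k_2 by (rule cochains_tensor) (auto intro!: K1t_closed gens_K1t)

lemma hopf_B_u1: "hopf_B u1 =\<^sub>\<otimes> - c1K"
proof -
  have B: "hopf_B u1 \<in> cochains 1 \<and> (\<forall>a b. chi_tau (hopf_B u1) [a, b] = connes_B (chi_tau u1) a b)"
    unfolding hopf_B_def
    by (rule someI[of _ "- c1K"]) (use cochains_uminus[OF c1K_cochain] connes_B_u1 in auto)
  have "hopf_B u1 - (- c1K) \<in> tensor_null"
  proof (rule chi_tau_injective)
    show "hopf_B u1 - (- c1K) \<in> cochains 1"
      using B by (intro cochains_diff cochains_uminus c1K_cochain) simp
    show "chi_tau (hopf_B u1 - (- c1K)) [a, b] = 0" for a b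
      unfolding Modules.additive.diff[OF additive_chi_tau] using B connes_B_u1[of a b] by (metis diff_self)
  qed
  then show ?thesis by (simp add: tensor_eq_def)
qed

theorem proposition6p4:
  "u1 \<in> cochains 2 \<and> hochschild_b u1 =\<^sub>\<otimes> 0 \<and>
   normalized2 (chi_tau u1) \<and>
   (\<forall>a b. connes_B (chi_tau u1) a b = chi_tau (- c1K) [a, b]) \<and>
   hopf_B u1 =\<^sub>\<otimes> - c1K"
proof -
  have "u1 \<in> cochains 2"
    unfolding u1_def by (rule cochains_tensor) (auto intro: K1t_closed gens_K1t)
  then show ?thesis
    using hochschild_u1 normalized_u1 connes_B_u1 hopf_B_u1 by blast
qed

end
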